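(* Consider the following fragmentation process. Start with a rod of integer length $\ell=\ell_0$. In iteration $k$, select an integer $X_k\in[1,\ell_k]$ with uniform probability and fracture the rod (of current length $\ell_k$) so that one is left with a piece of length $X_k$ and a piece of length $\ell_{k+1}:=\ell_k-X_k$. Continue this process, fracturing the piece of length $\ell_{k+1}$ in the next iteration, until $\ell_k=0$. Let $\{X_\ell\}$ denote the (random) set of the lengths $X_k$ produced when the initial length is $\ell$. Then, as $\ell\to\infty$, the distribution of $\{X_\ell\}$ converges to (strong) Benford behavior with probability $1$.
   Context: Every $x>0$ is written uniquely as $x=S_{10}(x)\cdot 10^{k}$ with $k\in\mathbb{Z}$ and significand $S_{10}(x)\in[1,10)$. Strong Benford behavior (base 10) is the statement about the whole significand, not just the first digit: the proportion of elements with significand at most $s$ is $\log_{10}s$ for every $s\in[1,10)$; convergence to strong Benford behavior means that this proportion tends to $\log_{10}s$ for every such $s$. A given length may occur several times among the $X_k$, and each length is counted with its frequency. *)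

theory Defs
  imports "HOL-Probability.Probability"
begin

definition significand10 :: "real \<Rightarrow> real" where
  "significand10 x = (THE s. 1 \<le> s \<and> s < 10 \<and> (\<exists>k::int. x = s * 10 powi k))"

lemma significand10_unique:
  fixes x :: real
  assumes "x > 0"
  shows "\<exists>!s. 1 \<le> s \<and> s < 10 \<and> (\<exists>k::int. x = s * 10 powi k)"
proof -
  have key: "s = x / 10 powi \<lfloor>log 10 x\<rfloor>" if s: "1 \<le> s" "s < 10" "x = s * 10 powi k" for s k
  proof -
    have "log 10 x = log 10 s + of_int k"
      using s by (simp add: log_mult flip: powr_real_of_int')
    moreover have "0 \<le> log 10 s" "log 10 s < 1"
      using s by (auto simp: log_less_iff)
    ultimately have "\<lfloor>log 10 x\<rfloor> = k" by linarith
    with s(3) show ?thesis by simp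
  qed
  define k where "k = \<lfloor>log 10 x\<rfloor>"
  have x: "x = 10 powr log 10 x" using assms by simp
  have p: "10 powi k = (10::real) powr of_int k" by (simp add: powr_real_of_int')
  have "10 powr of_int k \<le> 10 powr log 10 x"
    by (rule powr_mono) (auto simp: k_def)
  moreover have "10 powr log 10 x < 10 powr (of_int k + 1)"
    by (rule powr_less_mono) (auto simp: k_def)
  ultimately have "10 powi k \<le> x" "x < 10 * 10 powi k"
    using assms by (simp_all add: p powr_add)
  then have "1 \<le> x / 10 powi k \<and> x / 10 powi k < 10 \<and> (\<exists>j::int. x = x / 10 powi k * 10 powi j)"
    by (auto simp: field_simps intro!: exI[of _ k])
  then show ?thesis
    unfolding k_def using key by (intro ex1I) blast+
qed

(* Lists are used so that a length occurring several times is counted with its frequency. *)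
definition significand_proportion :: "nat list \<Rightarrow> real \<Rightarrow> real" where
  "significand_proportion xs s =
     real (length (filter (\<lambda>x. significand10 (real x) \<le> s) xs)) / real (length xs)"

definition converges_to_strong_Benford :: "(nat \<Rightarrow> nat list) \<Rightarrow> bool" where
  "converges_to_strong_Benford L \<longleftrightarrow>
     (\<forall>s. 1 \<le> s \<and> s < 10 \<longrightarrow> (\<lambda>n. significand_proportion (L n) s) \<longlonglongrightarrow> log 10 s)"

(* The law of the list [X_0, X_1, ...] of all pieces broken off a rod of length n: the first
   piece is uniform on {1..n}, and the rod of length n - X_0 is then fragmented in the same way,
   until nothing is left. *)
function fragmentation_pmf :: "nat \<Rightarrow> nat list pmf" where
  "fragmentation_pmf n =
     (if n = 0 then return_pmf []
      else bind_pmf (pmf_of_set {1..n}) (\<lambda>x. map_pmf ((#) x) (fragmentation_pmf (n - x))))"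
  by auto
termination
  by (relation "Wellfounded.measure id") auto

declare fragmentation_pmf.simps [simp del]

(* Almost sure convergence as the initial length n tends to infinity needs the processes for
   all n on one probability space. They are realised by iid variables u 0, u 1, ..., uniform
   on [0,1), shared by all n: at step k the rod of current length m is cut at
   floor (u k * m) + 1, which is uniform on {1..m}. For each single n this has exactly the law
   fragmentation_pmf n (lemma distr_fragmentation_path below). *)
definition uniform_cut :: "real \<Rightarrow> nat \<Rightarrow> nat" where
  "uniform_cut t n = nat \<lfloor>t * real n\<rfloor> + 1"

function fragmentation_path :: "(nat \<Rightarrow> real) \<Rightarrow> nat \<Rightarrow> nat list" where
  "fragmentation_path u n =
     (if n = 0 then []
      else let x = uniform_cut (u 0) n in x # fragmentation_path (\<lambda>k. u (Suc k)) (n - x))"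
  by auto
termination
  by (relation "Wellfounded.measure snd") (auto simp: uniform_cut_def)

declare fragmentation_path.simps [simp del]

abbreviation uniform01 :: "real measure" where
  "uniform01 \<equiv> uniform_measure lborel {0..<1}"

definition iid_uniform :: "(nat \<Rightarrow> real) measure" where
  "iid_uniform = (\<Pi>\<^sub>M k\<in>UNIV. uniform01)"

interpretation iid: product_prob_space "\<lambda>_::nat. uniform01" UNIV
proof -
  have *: "prob_space uniform01"
    by (rule prob_space_uniform_measure) auto
  then interpret prob_space uniform01 .
  show "product_prob_space (\<lambda>_::nat. uniform01)"
    by unfold_locales
qed

lemma emeasure_uniform_cut:
  assumes "n > 0"
  shows "emeasure uniform01 {t. uniform_cut t n = x} = (if x \<in> {1..n} then ennreal (1 / n) else 0)"
proof -
  have m: "{t. uniform_cut t n = x} \<in> sets borel"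
    unfolding uniform_cut_def by measurable
  have "uniform_cut t n = x \<longleftrightarrow> 1 \<le> x \<and> (real x - 1) / n \<le> t \<and> t < real x / n" 
    if "0 \<le> t" for t
  proof -
    have f: "0 \<le> \<lfloor>t * real n\<rfloor>" using that by simp
    have "uniform_cut t n = x \<longleftrightarrow> \<lfloor>t * real n\<rfloor> = int x - 1"
      using f unfolding uniform_cut_def by linarith
    also have "\<dots> \<longleftrightarrow> real x - 1 \<le> t * n \<and> t * n < real x"
      by (auto simp: floor_eq_iff)
    also have "\<dots> \<longleftrightarrow> 1 \<le> x \<and> real x - 1 \<le> t * n \<and> t * n < real x"
    proof -
      have "0 \<le> t * n" using that by simp
      then have "t * n < real x \<Longrightarrow> 1 \<le> x" by (cases x) auto
      then show ?thesis by auto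
    qed
    finally show ?thesis using assms by (simp add: field_simps)
  qed
  note iff = this
  have "{0..<1} \<inter> {t. uniform_cut t n = x} =
      {t. 0 \<le> t \<and> t < 1 \<and> 1 \<le> x \<and> (real x - 1) / n \<le> t \<and> t < real x / n}"
  proof (intro set_eqI)
    fix t
    show "t \<in> {0..<1} \<inter> {t. uniform_cut t n = x} \<longleftrightarrow>
      t \<in> {t. 0 \<le> t \<and> t < 1 \<and> 1 \<le> x \<and> (real x - 1) / n \<le> t \<and> t < real x / n}"
      by (cases "0 \<le> t") (simp add: iff, simp)
  qed
  also have "\<dots> = (if x \<in> {1..n} then {(real x - 1) / n ..< real x / n} else {})"
  proof (cases "x \<in> {1..n}")
    case True
    then have "0 \<le> (real x - 1) / n" "real x / n \<le> 1"
      using assms by auto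
    then have "0 \<le> t \<and> t < 1" if "(real x - 1) / n \<le> t" "t < real x / n" for t
      using that by linarith
    then show ?thesis using True by auto
  next
    case False
    have "1 \<le> (real x - 1) / n" if "\<not> x \<le> n"
      using that assms by (simp add: field_simps)
    then have "\<not> (t < 1 \<and> (real x - 1) / n \<le> t)" if "\<not> x \<le> n" for t
      using that by fastforce
    then show ?thesis using False by auto
  qed
  finally have e: "{0..<1} \<inter> {t. uniform_cut t n = x} = \<dots>" .
  have "real x / real n - (real x - 1) / real n = 1 / n"
    by (simp add: diff_divide_distrib)
  moreover have "(real x - 1) / real n \<le> real x / real n"
    by (simp add: divide_right_mono)
  ultimately show ?thesis
    using m by (auto simp: e divide_ennreal_def)
qed

(* fragmentation_path u n = xs says that n - sum_list xs = 0 and u k \<in> cut_event n xs k for all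
   k < length xs. *)
primrec cut_event :: "nat \<Rightarrow> nat list \<Rightarrow> nat \<Rightarrow> real set" where
  "cut_event n [] k = UNIV"
| "cut_event n (x # xs) k =
     (case k of 0 \<Rightarrow> {t. n > 0 \<and> uniform_cut t n = x} | Suc j \<Rightarrow> cut_event (n - x) xs j)"

lemma cut_event_sets: "cut_event n xs k \<in> sets borel"
proof (induction xs arbitrary: n k)
  case (Cons x xs)
  have "{t. n > 0 \<and> uniform_cut t n = x} \<in> sets borel"
    unfolding uniform_cut_def by measurable
  then show ?case
    by (cases k) (simp_all only: cut_event.simps nat.case Cons.IH)
qed simp

lemma fragmentation_path_eq_iff:
  "fragmentation_path u n = xs \<longleftrightarrow>
     n - sum_list xs = 0 \<and> (\<forall>k\<in>{..<length xs}. u k \<in> cut_event n xs k)"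
proof (induction xs arbitrary: u n)
  case Nil
  then show ?case by (simp add: fragmentation_path.simps Let_def)
next
  case (Cons x xs)
  show ?case
  proof (cases "n = 0")
    case True
    then show ?thesis
      by (simp add: fragmentation_path.simps[of u 0] lessThan_Suc_eq_insert_0)
  next
    case False
    then have "fragmentation_path u n = x # xs \<longleftrightarrow>
        uniform_cut (u 0) n = x \<and> fragmentation_path (\<lambda>k. u (Suc k)) (n - x) = xs"
      by (subst fragmentation_path.simps) (auto simp: Let_def)
    then show ?thesis
      using False unfolding Cons.IH by (auto simp: lessThan_Suc_eq_insert_0)
  qed
qed

lemma pmf_fragmentation:
  "ennreal (pmf (fragmentation_pmf n) xs) =
     (if n - sum_list xs = 0 then \<Prod>k<length xs. emeasure uniform01 (cut_event n xs k) else 0)"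
proof (induction xs arbitrary: n)
  case Nil
  have "[] \<notin> set_pmf (fragmentation_pmf n)" if "n > 0"
    using that by (subst fragmentation_pmf.simps) auto
  then show ?case
    by (auto simp: set_pmf_iff fragmentation_pmf.simps[of 0])
next
  case (Cons x xs)
  show ?case
  proof (cases "n = 0")
    case True
    then show ?thesis
      by (simp add: fragmentation_pmf.simps[of 0] lessThan_Suc_eq_insert_0)
  next
    case False
    have p: "pmf (map_pmf ((#) y) P) (x # xs) = (if y = x then pmf P xs else 0)" for y P
      by (auto simp: pmf_map_inj' inj_def pmf_eq_0_set_pmf)
    have "pmf (fragmentation_pmf n) (x # xs) =
        (if x \<in> {1..n} then 1 / n * pmf (fragmentation_pmf (n - x)) xs else 0)"
      using False
      by (subst fragmentation_pmf.simps) (auto simp: pmf_bind_pmf_of_set p)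
    then have "ennreal (pmf (fragmentation_pmf n) (x # xs)) =
        emeasure uniform01 {t. uniform_cut t n = x} * ennreal (pmf (fragmentation_pmf (n - x)) xs)"
      using False
      by (simp add: emeasure_uniform_cut flip: ennreal_mult'' del: emeasure_uniform_measure)
    then show ?thesis
      using False
      by (simp add: Cons.IH prod.lessThan_Suc_shift diff_diff_left del: emeasure_uniform_measure
          prod.lessThan_Suc)
  qed
qed

lemma distr_fragmentation_path:
  "distr iid_uniform (count_space UNIV) (\<lambda>u. fragmentation_path u n) =
     measure_pmf (fragmentation_pmf n)"
proof (rule measure_eqI_countable[of _ UNIV])
  have sp: "space iid_uniform = UNIV" by (simp add: iid_uniform_def space_PiM)
  have ev: "{u. fragmentation_path u n = xs} \<in> sets iid_uniform" for xs
  proof -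
    have [measurable]: "cut_event n xs k \<in> sets borel" for k by (rule cut_event_sets)
    have "{u \<in> space iid_uniform. n - sum_list xs = 0 \<and> (\<forall>k\<in>{..<length xs}. u k \<in> cut_event n xs k)}
            \<in> sets iid_uniform"
      unfolding iid_uniform_def by measurable
    then show ?thesis by (simp add: fragmentation_path_eq_iff sp)
  qed
  then have m: "(\<lambda>u. fragmentation_path u n) \<in> iid_uniform \<rightarrow>\<^sub>M count_space UNIV"
    by (intro measurable_count_space_eq2_countable[THEN iffD2])
       (auto simp: sp vimage_def)
  fix xs :: "nat list"
  have "emeasure (distr iid_uniform (count_space UNIV) (\<lambda>u. fragmentation_path u n)) {xs} =
      emeasure iid_uniform {u. fragmentation_path u n = xs}"
    using m by (subst emeasure_distr) (auto simp: sp vimage_def)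
  also have "\<dots> = (if n - sum_list xs = 0
      then \<Prod>k<length xs. emeasure uniform01 (cut_event n xs k) else 0)"
    using iid.emeasure_PiM_Collect[of "{..<length xs}" "cut_event n xs"]
    by (simp add: fragmentation_path_eq_iff cut_event_sets iid_uniform_def space_PiM
        del: emeasure_uniform_measure)
  also have "\<dots> = emeasure (measure_pmf (fragmentation_pmf n)) {xs}"
    by (simp only: pmf_fragmentation emeasure_pmf_single)
  finally show "emeasure (distr iid_uniform (count_space UNIV) (\<lambda>u. fragmentation_path u n)) {xs} =
      emeasure (measure_pmf (fragmentation_pmf n)) {xs}" .
qed auto

end

theory Submission
  imports Defs "HOL-Library.Discrete_Functions" "HOL-Real_Asymp.Real_Asymp"
begin

text \<open>
  Let \<open>V\<^sub>k = (1 - u\<^sub>0) \<cdots> (1 - u\<^sub>k\<^sub>-\<^sub>1)\<close>. Rounding costs at most one unit of length per step, so the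
  rod left after \<open>k\<close> steps differs from \<open>n V\<^sub>k\<close> by at most \<open>k\<close> and the piece \<open>X\<^sub>k\<close> differs from
  \<open>n u\<^sub>k V\<^sub>k\<close> by at most \<open>k + 1\<close>. As \<open>- ln (1 - u\<^sub>i)\<close> is exponentially distributed, the law of large
  numbers gives \<open>u\<^sub>k V\<^sub>k = exp (- k + o(k))\<close>, so the process stops after \<open>(1 + o(1)) ln n\<close> steps, and
  for all but \<open>o(ln n)\<close> of them \<open>ln X\<^sub>k - ln (n u\<^sub>k V\<^sub>k)\<close> is uniformly small. By Weyl's criterion it
  remains to see that the averages of \<open>exp (\<i> \<tau> ln (u\<^sub>k V\<^sub>k))\<close> tend to \<open>0\<close> for \<open>\<tau> = 2 \<pi> h / ln 10\<close>,
  \<open>h \<noteq> 0\<close>; the factor \<open>n\<close> only rotates these averages, which is why one almost sure event serves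
  all \<open>n\<close> at once. The correlation of the terms \<open>j < k\<close> decays geometrically in \<open>k - j\<close>, because
  \<open>(1 - u\<^sub>i)\<^bsup>\<i>\<tau>\<^esup>\<close> has mean \<open>1 / (1 + \<i> \<tau>)\<close>, of modulus below \<open>1\<close>; so a second moment
  bound gives almost sure convergence along the squares, which suffices.
\<close>

section \<open>Weyl's criterion for lists of growing length\<close>

definition list_mean :: "('a \<Rightarrow> 'b::real_normed_vector) \<Rightarrow> 'a list \<Rightarrow> 'b" where
  "list_mean f xs = (\<Sum>x\<leftarrow>xs. f x) /\<^sub>R real (length xs)"

lemma list_mean_add: "list_mean (\<lambda>x. f x + g x) xs = list_mean f xs + list_mean g xs"
  by (simp add: list_mean_def sum_list_addf scaleR_add_right)

lemma list_mean_diff: "list_mean (\<lambda>x. f x - g x) xs = list_mean f xs - list_mean g xs"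
  by (simp add: list_mean_def sum_list_subtractf scaleR_diff_right)

lemma list_mean_linear:
  assumes "linear h"
  shows "list_mean (\<lambda>x. h (f x)) xs = h (list_mean f xs)"
proof -
  have "(\<Sum>x\<leftarrow>xs. h (f x)) = h (\<Sum>x\<leftarrow>xs. f x)"
    by (induction xs) (simp_all add: linear_0[OF assms] linear_add[OF assms])
  then show ?thesis by (simp add: list_mean_def linear_cmul[OF assms])
qed

lemma list_mean_const:
  "list_mean (\<lambda>_. c) xs = (if xs = [] then 0 else c)"
proof -
  have "(\<Sum>x\<leftarrow>xs. c) = real (length xs) *\<^sub>R c"
    by (induction xs) (simp_all add: algebra_simps)
  then show ?thesis by (simp add: list_mean_def)
qed

lemma list_mean_mono:
  fixes f :: "'a \<Rightarrow> real"
  assumes "\<And>x. x \<in> set xs \<Longrightarrow> f x \<le> g x"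
  shows "list_mean f xs \<le> list_mean g xs"
  unfolding list_mean_def by (simp add: assms sum_list_mono divide_right_mono mult_left_mono)

lemma norm_list_mean_le: "norm (list_mean f xs) \<le> list_mean (\<lambda>x. norm (f x)) xs"
proof -
  have "norm (\<Sum>x\<leftarrow>xs. f x) \<le> (\<Sum>x\<leftarrow>xs. norm (f x))"
    by (induction xs) (auto intro: norm_triangle_mono)
  then show ?thesis
    unfolding list_mean_def by (simp add: mult_left_mono)
qed

lemma list_mean_of_bool:
  "list_mean (\<lambda>x. of_bool (P x)) xs = real (length (filter P xs)) / real (length xs)"
proof -
  have "(\<Sum>x\<leftarrow>xs. of_bool (P x)) = real (length (filter P xs))"
    by (induction xs) auto
  then show ?thesis by (simp add: list_mean_def field_simps)
qed

lemma list_mean_map: "list_mean f (map g xs) = list_mean (\<lambda>x. f (g x)) xs"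
  by (simp add: list_mean_def o_def)

lemma list_mean_cong: "(\<And>x. x \<in> set xs \<Longrightarrow> f x = g x) \<Longrightarrow> list_mean f xs = list_mean g xs"
  unfolding list_mean_def by (simp cong: map_cong)

text \<open>Integer frequencies give period 1, so these are functions on the circle. Closure under
  products, which polynomial approximation requires, is derived below from the addition of
  frequencies.\<close>

inductive trig_polynomial :: "(real \<Rightarrow> complex) \<Rightarrow> bool" where
  monom: "trig_polynomial (\<lambda>x. c * cis (2 * pi * (of_int h * x)))"
| add: "trig_polynomial f \<Longrightarrow> trig_polynomial g \<Longrightarrow> trig_polynomial (\<lambda>x. f x + g x)"

lemma trig_polynomial_mult_monom:
  assumes "trig_polynomial g"
  shows "trig_polynomial (\<lambda>x. c * cis (2 * pi * (of_int h * x)) * g x)"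
  using assms
proof induction
  case (monom d k)
  have "(\<lambda>x. c * cis (2 * pi * (of_int h * x)) * (d * cis (2 * pi * (of_int k * x)))) =
      (\<lambda>x. (c * d) * cis (2 * pi * (of_int (h + k) * x)))"
    by (rule ext) (simp add: cis_mult[symmetric] ring_distribs)
  then show ?case by (simp only: trig_polynomial.monom)
next
  case (add f g)
  then show ?case by (simp only: distrib_left trig_polynomial.add)
qed

lemma trig_polynomial_mult:
  assumes "trig_polynomial f" "trig_polynomial g"
  shows "trig_polynomial (\<lambda>x. f x * g x)"
  using assms(1)
  by induction (simp_all only: trig_polynomial_mult_monom assms(2) distrib_right trig_polynomial.add)

text \<open>Connects Stone-Weierstrass approximation by polynomials on the plane with exponential
  sums. Sums and products are covered by closure, so only linear functionals and constants need
  work.\<close>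

lemma trig_polynomial_real_polynomial_function:
  fixes p :: "complex \<Rightarrow> real"
  assumes "real_polynomial_function p"
  shows "trig_polynomial (\<lambda>x. of_real (p (cis (2 * pi * x))))"
  using assms
proof induction
  case (linear p)
  then interpret bounded_linear p .
  define a where "a = (of_real (p 1) :: complex)"
  define b where "b = (of_real (p \<i>) :: complex)"
  \<comment> \<open>Euler's formulas for \<open>cos t\<close> and \<open>sin t\<close>, inserted
    into \<open>cos t * p 1 + sin t * p \<i>\<close>.\<close>
  have p: "of_real (p (cis t)) = (a - \<i> * b) / 2 * cis t + (a + \<i> * b) / 2 * cis (- t)" for t
  proof -
    have "cis t = cos t *\<^sub>R 1 + sin t *\<^sub>R \<i>"
      by (simp add: complex_eq_iff)
    then have "p (cis t) = cos t * p 1 + sin t * p \<i>"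
      by (simp only: add scaleR) simp
    then show ?thesis
      by (simp add: a_def b_def complex_eq_iff field_simps)
  qed
  have "trig_polynomial (\<lambda>x. (a - \<i> * b) / 2 * cis (2 * pi * (of_int 1 * x)) +
      (a + \<i> * b) / 2 * cis (2 * pi * (of_int (-1) * x)))"
    by (intro trig_polynomial.intros)
  then show ?case by (simp add: p)
next
  case (const c)
  show ?case using trig_polynomial.monom[of "of_real c" 0] by simp
qed (simp_all add: trig_polynomial.add trig_polynomial_mult)

lemma has_integral_cis:
  assumes "h \<noteq> (0::int)"
  shows "((\<lambda>x. cis (2 * pi * (of_int h * x))) has_integral 0) {0..1}"
proof -
  define w where "w = 2 * pi * of_int h"
  have w: "w \<noteq> 0" using assms by (simp add: w_def)
  have "((\<lambda>x. cis (w * x) / (\<i> * of_real w)) has_vector_derivative cis (w * x)) (at x within {0..1})" for x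
  proof -
    have "((\<lambda>z. exp (\<i> * (of_real w * z)) / (\<i> * of_real w)) has_field_derivative cis (w * x)) (at (of_real x))"
      using w by (auto intro!: derivative_eq_intros simp: cis_conv_exp mult_ac)
    from has_vector_derivative_real_field[OF this] show ?thesis
      by (auto simp: o_def cis_conv_exp intro: has_vector_derivative_at_within)
  qed
  then have "((\<lambda>x. cis (w * x)) has_integral (cis (w * 1) / (\<i> * of_real w) - cis (w * 0) / (\<i> * of_real w))) {0..1}"
    by (intro fundamental_theorem_of_calculus) auto
  moreover have "cis w = 1"
    unfolding w_def by simp
  ultimately have "((\<lambda>x. cis (w * x)) has_integral 0) {0..1}" by simp
  then show ?thesis by (simp add: w_def mult.assoc)
qed

section \<open>Equidistribution from vanishing exponential sums\<close>

context
  fixes L :: "nat \<Rightarrow> real list"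
  assumes nonempty: "eventually (\<lambda>n. L n \<noteq> []) sequentially"
  assumes weyl: "\<And>h::int. h \<noteq> 0 \<Longrightarrow> (\<lambda>n. list_mean (\<lambda>x. cis (2 * pi * (of_int h * x))) (L n)) \<longlonglongrightarrow> 0"
begin

lemma list_mean_trig_polynomial:
  assumes "trig_polynomial f"
  shows "f integrable_on {0..1} \<and> (\<lambda>n. list_mean f (L n)) \<longlonglongrightarrow> integral {0..1} f"
  using assms
proof induction
  case (monom c h)
  have lin: "linear (\<lambda>z. c * z)"
    using bounded_linear_mult_right bounded_linear.linear by blast
  show ?case
  proof (cases "h = 0")
    case True
    \<comment> \<open>Nonemptiness enters here: the mean of a constant over the empty list is
      0.\<close>
    have "(\<lambda>n. list_mean (\<lambda>_. c) (L n)) \<longlonglongrightarrow> c"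
      by (rule tendsto_eventually, use nonempty in eventually_elim) (simp add: list_mean_const)
    with True show ?thesis by (simp add: integrable_continuous_real)
  next
    case False
    have "((\<lambda>x. c * cis (2 * pi * (of_int h * x))) has_integral 0) {0..1}"
      using has_integral_mult_right[OF has_integral_cis[OF False], of c] by simp
    moreover have "(\<lambda>n. list_mean (\<lambda>x. c * cis (2 * pi * (of_int h * x))) (L n)) \<longlonglongrightarrow> 0"
      unfolding list_mean_linear[OF lin] by (rule tendsto_mult_right_zero[OF weyl[OF False]])
    ultimately show ?thesis
      by (simp only: has_integral_iff simp_thms)
  qed
next
  case (add f g)
  then show ?case
    by (auto intro!: integrable_add tendsto_add simp: list_mean_add integral_add)
qed

text \<open>A polynomial within \<open>e / 3\<close> of \<open>g\<close> on the circle changes both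
  the list mean and the integral by at most \<open>e / 3\<close>, and for the polynomial the limit
  is known. Stating this for functions on the circle builds in periodicity and provides the compact
  set for Stone-Weierstrass.\<close>

lemma list_mean_continuous:
  fixes g :: "complex \<Rightarrow> real"
  assumes g: "continuous_on (sphere 0 1) g"
  shows "(\<lambda>n. list_mean (\<lambda>x. g (cis (2 * pi * x))) (L n)) \<longlonglongrightarrow> integral {0..1} (\<lambda>x. g (cis (2 * pi * x)))"
proof (rule LIMSEQ_I)
  fix e :: real assume e: "e > 0"
  obtain p where p: "real_polynomial_function p" "\<And>z. z \<in> sphere 0 1 \<Longrightarrow> \<bar>g z - p z\<bar> < e / 3"
    using Stone_Weierstrass_real_polynomial_function[OF compact_sphere g, of "e / 3"] e by auto
  let ?g = "\<lambda>x. g (cis (2 * pi * x))" and ?p = "\<lambda>x. p (cis (2 * pi * x))"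
  have close: "\<bar>?g x - ?p x\<bar> < e / 3" for x
    by (rule p(2)) simp
  have g_int: "?g integrable_on {0..1}"
    by (intro integrable_continuous_real continuous_on_compose2[OF g] continuous_intros) auto
  have tp: "(\<lambda>x. of_real (?p x) :: complex) integrable_on {0..1}"
    "(\<lambda>n. list_mean (\<lambda>x. of_real (?p x) :: complex) (L n)) \<longlonglongrightarrow> integral {0..1} (\<lambda>x. of_real (?p x))"
    using list_mean_trig_polynomial[OF trig_polynomial_real_polynomial_function[OF p(1)]] by auto
  have p_int: "?p integrable_on {0..1}"
    using integrable_linear[OF tp(1) bounded_linear_Re] by (simp add: o_def)
  have "integral {0..1} (\<lambda>x. of_real (?p x) :: complex) = of_real (integral {0..1} ?p)"
    using integral_linear[OF p_int bounded_linear_of_real] by (simp add: o_def)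
  with tp(2) have "(\<lambda>n. list_mean ?p (L n)) \<longlonglongrightarrow> integral {0..1} ?p"
    by (simp add: list_mean_linear[OF bounded_linear.linear[OF bounded_linear_of_real]] tendsto_of_real_iff)
  from LIMSEQ_D[OF this, of "e / 3"] e obtain N where
    N: "\<And>n. n \<ge> N \<Longrightarrow> \<bar>list_mean ?p (L n) - integral {0..1} ?p\<bar> < e / 3" by auto
  have "integral {0..1} ?g - integral {0..1} ?p = integral {0..1} (\<lambda>x. ?g x - ?p x)"
    by (rule integral_diff[OF g_int p_int, symmetric])
  moreover have "norm (integral {0..1} (\<lambda>x. ?g x - ?p x)) \<le> integral {0..1} (\<lambda>_::real. e / 3)"
    using close by (intro integral_norm_bound_integral integrable_diff g_int p_int) (auto intro: less_imp_le)
  ultimately have i: "\<bar>integral {0..1} ?g - integral {0..1} ?p\<bar> \<le> e / 3" by simp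
  have m: "\<bar>list_mean ?g (L n) - list_mean ?p (L n)\<bar> \<le> e / 3" for n
  proof -
    have "\<bar>list_mean ?g (L n) - list_mean ?p (L n)\<bar> \<le> list_mean (\<lambda>x. \<bar>?g x - ?p x\<bar>) (L n)"
      using norm_list_mean_le[of "\<lambda>x. ?g x - ?p x" "L n"] by (simp add: list_mean_diff)
    also have "\<dots> \<le> list_mean (\<lambda>_. e / 3) (L n)"
      using close by (intro list_mean_mono) (auto intro: less_imp_le)
    also have "\<dots> \<le> e / 3" using e by (simp add: list_mean_const)
    finally show ?thesis .
  qed
  have "norm (list_mean ?g (L n) - integral {0..1} ?g) < e" if "n \<ge> N" for n
    unfolding real_norm_def using N[OF that] i m[of n] by linarith
  then show "\<exists>N. \<forall>n\<ge>N. norm (list_mean ?g (L n) - integral {0..1} ?g) < e" by blast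
qed

text \<open>The indicator of the closed arc \<open>C\<close> lies below the continuous functions
  \<open>g m\<close>, which converge to it pointwise. By dominated convergence some fixed
  \<open>m\<close> has integral below \<open>b - a + e\<close>, and the continuous case applies to
  this \<open>g m\<close>.\<close>

lemma list_mean_arc_le:
  assumes ab: "0 \<le> a" "a \<le> b" "b \<le> 1" and e: "e > 0"
  shows "eventually (\<lambda>n. list_mean (\<lambda>x. of_bool (frac x \<in> {a..b}) :: real) (L n) \<le> b - a + e) sequentially"
proof -
  define C where "C = (\<lambda>x. cis (2 * pi * x)) ` {a..b}"
  have C: "compact C" "C \<noteq> {}"
    unfolding C_def using ab by (auto intro!: compact_continuous_image continuous_intros)
  define g where "g m z = max 0 (1 - real m * infdist z C)" for m z
  let ?g = "\<lambda>m x. g m (cis (2 * pi * x))"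
  have g_cont: "continuous_on S (g m)" for S m
    unfolding g_def by (intro continuous_intros)
  have lim: "(\<lambda>m. g m z) \<longlonglongrightarrow> of_bool (z \<in> C)" for z
  proof (cases "z \<in> C")
    case True
    then show ?thesis by (simp add: g_def)
  next
    case False
    \<comment> \<open>Closedness of \<open>C\<close> keeps points outside it at positive distance,
      so \<open>g m\<close> vanishes there for large \<open>m\<close>.\<close>
    then have d: "infdist z C > 0"
      using C by (metis compact_imp_closed in_closed_iff_infdist_zero infdist_nonneg order_le_less)
    obtain M where "real M > 1 / infdist z C" using reals_Archimedean2 by blast
    then have "g m z = 0" if "m \<ge> M" for m
    proof -
      have "1 / infdist z C < real m" using \<open>real M > _\<close> that by linarith
      then show ?thesis using d by (simp add: g_def field_simps)
    qed
    then show ?thesis using False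
      by (auto intro!: tendsto_eventually eventually_sequentiallyI)
  qed
  have "(\<lambda>m. integral {0..1} (?g m)) \<longlonglongrightarrow> integral {0..1} (\<lambda>x. of_bool (cis (2 * pi * x) \<in> C))"
  proof (rule dominated_convergence)
    show "?g m integrable_on {0..1}" for m
      by (intro integrable_continuous_real continuous_on_compose2[OF g_cont] continuous_intros) auto
    show "(\<lambda>_::real. 1::real) integrable_on {0..1}" by (rule integrable_continuous_real) (rule continuous_on_const)
    show "norm (?g m x) \<le> 1" for m x
      unfolding g_def using mult_nonneg_nonneg[OF of_nat_0_le_iff infdist_nonneg, of m] by (auto simp: max_def)
  qed (rule lim)
  moreover have "integral {0..1} (\<lambda>x. of_bool (cis (2 * pi * x) \<in> C)) = b - a"
  proof -
    \<comment> \<open>The endpoints 0 and 1 are the same point of the circle, so 1 can be sent into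
      \<open>C\<close> although \<open>b < 1\<close>. Removing both does not change the
      integral.\<close>
    have eq: "cis (2 * pi * x) \<in> C \<longleftrightarrow> x \<in> {a..b}" if "x \<in> {0..1} - {0,1}" for x
    proof
      assume "cis (2 * pi * x) \<in> C"
      then obtain y where y: "y \<in> {a..b}" "cis (2 * pi * x) = cis (2 * pi * y)" by (auto simp: C_def)
      then have "cis (2 * pi * (x - y)) = 1"
        by (simp add: right_diff_distrib flip: cis_divide)
      then have "cos (2 * pi * (x - y)) = 1" by (metis cis.sel(1) one_complex.sel(1))
      then obtain n :: int where "2 * pi * (x - y) = 2 * pi * of_int n"
        unfolding cos_one_2pi_int by (auto simp: mult_ac)
      then have n: "x - y = of_int n" by simp
      have "\<bar>x - y\<bar> < 1" using that y ab by auto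
      then have "n = 0" using n by linarith
      then show "x \<in> {a..b}" using n y by simp
    qed (simp add: C_def)
    have "{a..b} \<subseteq> {0..1}" using ab by auto
    moreover have "((\<lambda>_. 1::real) has_integral (b - a)) {a..b}"
      using has_integral_const_real[of "1::real" a b] ab by simp
    ultimately have "((\<lambda>x. if x \<in> {a..b} then 1 else 0::real) has_integral (b - a)) {0..1}"
      by (simp only: has_integral_restrict)
    then have "((\<lambda>x. of_bool (cis (2 * pi * x) \<in> C)) has_integral (b - a)) {0..1}"
      by (rule has_integral_spike_finite[where S = "{0,1}", rotated 2]) (auto simp: eq)
    then show ?thesis by (rule integral_unique)
  qed
  ultimately have "eventually (\<lambda>m. integral {0..1} (?g m) < b - a + e) sequentially"
    using e by (intro order_tendstoD(2)) auto
  then obtain m where m: "integral {0..1} (?g m) < b - a + e"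
    by (auto simp: eventually_sequentially)
  have "eventually (\<lambda>n. list_mean (?g m) (L n) < b - a + e) sequentially"
    using m by (intro order_tendstoD(2)[OF list_mean_continuous] g_cont)
  moreover have "list_mean (\<lambda>x. of_bool (frac x \<in> {a..b}) :: real) (L n) \<le> list_mean (?g m) (L n)" for n
  proof (rule list_mean_mono)
    fix x
    have "2 * pi * x = 2 * pi * frac x + 2 * pi * of_int \<lfloor>x\<rfloor>"
      by (simp add: frac_def right_diff_distrib)
    then have "cis (2 * pi * x) = cis (2 * pi * frac x) * cis (2 * pi * of_int \<lfloor>x\<rfloor>)"
      by (simp only: cis_mult)
    then have "cis (2 * pi * x) = cis (2 * pi * frac x)" by simp
    then have "cis (2 * pi * x) \<in> C" if "frac x \<in> {a..b}" using that by (simp add: C_def)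
    then show "of_bool (frac x \<in> {a..b}) \<le> ?g m x"
      by (auto simp: g_def)
  qed
  ultimately show ?thesis by (auto elim!: eventually_mono intro: order_trans less_imp_le)
qed

text \<open>Upper bounds for closed arcs suffice: \<open>{t..1}\<close> covers the complement of \<open>{0..t}\<close>.\<close>

theorem weyl_criterion:
  assumes t: "0 \<le> t" "t < 1"
  shows "(\<lambda>n. list_mean (\<lambda>x. of_bool (frac x \<le> t)) (L n)) \<longlonglongrightarrow> t"
proof (rule LIMSEQ_I)
  fix e :: real assume "e > 0"
  then have "eventually (\<lambda>n. list_mean (\<lambda>x. of_bool (frac x \<in> {0..t})) (L n) \<le> t + e / 2) sequentially"
    "eventually (\<lambda>n. list_mean (\<lambda>x. of_bool (frac x \<in> {t..1})) (L n) \<le> 1 - t + e / 2) sequentially"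
    using list_mean_arc_le[of 0 t "e / 2"] list_mean_arc_le[of t 1 "e / 2"] t by auto
  with nonempty have "eventually (\<lambda>n. norm (list_mean (\<lambda>x. of_bool (frac x \<le> t)) (L n) - t) < e) sequentially"
  proof eventually_elim
    case (elim n)
    have "list_mean (\<lambda>x. 1 - of_bool (frac x \<in> {t..1}) :: real) (L n) \<le> list_mean (\<lambda>x. of_bool (frac x \<le> t)) (L n)"
      by (rule list_mean_mono) (auto simp: less_imp_le[OF frac_lt_1])
    with elim \<open>e > 0\<close> show ?case
      by (simp add: list_mean_diff list_mean_const abs_less_iff)
  qed
  then show "\<exists>N. \<forall>n\<ge>N. norm (list_mean (\<lambda>x. of_bool (frac x \<le> t)) (L n) - t) < e"
    by (simp add: eventually_sequentially)
qed

end

section \<open>The deterministic fragmentation path\<close>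

lemma significand10_eq_powr_frac:
  assumes "x > 0"
  shows "significand10 x = 10 powr frac (log 10 x)"
  unfolding significand10_def
proof (rule the1_equality[OF significand10_unique[OF assms]], intro conjI exI)
  show "1 \<le> 10 powr frac (log 10 x)" by (simp add: ge_one_powr_ge_zero)
  show "10 powr frac (log 10 x) < 10"
    using powr_less_mono[OF frac_lt_1, of 10 "log 10 x"] by simp
  have "x = 10 powr (frac (log 10 x) + of_int \<lfloor>log 10 x\<rfloor>)"
    using assms by (simp add: frac_def)
  then show "x = 10 powr frac (log 10 x) * 10 powi \<lfloor>log 10 x\<rfloor>"
    by (simp only: powr_add) (simp add: powr_real_of_int')
qed

lemma significand10_le_iff:
  assumes "x > 0" "s > 0"
  shows "significand10 x \<le> s \<longleftrightarrow> frac (log 10 x) \<le> log 10 s"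
  using assms by (simp add: significand10_eq_powr_frac le_log_iff)

text \<open>By truncated subtraction a used-up rod keeps length \<open>0\<close>.\<close>

primrec rod :: "(nat \<Rightarrow> real) \<Rightarrow> nat \<Rightarrow> nat \<Rightarrow> nat" where
  "rod u n 0 = n"
| "rod u n (Suc k) = rod u n k - uniform_cut (u k) (rod u n k)"

text \<open>\<open>fragmentation_path\<close> peels cuts off the front of the sequence, while
  \<open>rod\<close> appends them at the end; this identity reconciles the two recursions.\<close>

lemma rod_shift: "rod (\<lambda>k. u (Suc k)) (n - uniform_cut (u 0) n) k = rod u n (Suc k)"
  by (induction k) simp_all

lemma length_fragmentation_path_gt_iff: "k < length (fragmentation_path u n) \<longleftrightarrow> rod u n k > 0"
proof (induction u n arbitrary: k rule: fragmentation_path.induct)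
  case (1 u n)
  show ?case
  proof (cases "n = 0")
    case True
    have "rod u 0 k = 0" by (induction k) simp_all
    with True show ?thesis by (simp add: fragmentation_path.simps)
  next
    case False
    show ?thesis
      using False 1[OF False refl]
      by (cases k) (simp_all add: fragmentation_path.simps[of u n] rod_shift Let_def del: rod.simps(2))
  qed
qed

lemma nth_fragmentation_path:
  "k < length (fragmentation_path u n) \<Longrightarrow> fragmentation_path u n ! k = uniform_cut (u k) (rod u n k)"
proof (induction u n arbitrary: k rule: fragmentation_path.induct)
  case (1 u n)
  show ?case
  proof (cases "n = 0")
    case True
    with 1(2) show ?thesis by (simp add: fragmentation_path.simps)
  next
    case False
    show ?thesis
      using False 1(1)[OF False refl] 1(2)
      by (cases k) (simp_all add: fragmentation_path.simps[of u n] rod_shift Let_def del: rod.simps(2))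
  qed
qed

lemma list_mean_fragmentation_path:
  "list_mean f (fragmentation_path u n) =
     (\<Sum>k<length (fragmentation_path u n). f (uniform_cut (u k) (rod u n k))) /\<^sub>R
       real (length (fragmentation_path u n))"
proof -
  have "(\<Sum>x\<leftarrow>fragmentation_path u n. f x) = (\<Sum>k<length (fragmentation_path u n). f (fragmentation_path u n ! k))"
    by (simp add: sum_list_sum_nth atLeast0LessThan)
  then show ?thesis
    by (simp add: list_mean_def nth_fragmentation_path)
qed

text \<open>The fraction of the rod that would be left after \<open>k\<close> cuts without rounding,
  that is \<open>V\<^sub>k\<close>.\<close>

definition rest :: "(nat \<Rightarrow> real) \<Rightarrow> nat \<Rightarrow> real" where
  "rest u k = (\<Prod>i<k. 1 - u i)"

lemma real_diff_uniform_cut: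
  assumes "0 \<le> t" "t < 1"
  shows "real (m - uniform_cut t m) \<le> (1 - t) * m" "(1 - t) * m - 1 \<le> real (m - uniform_cut t m)"
proof -
  have f: "0 \<le> \<lfloor>t * m\<rfloor>" "of_int \<lfloor>t * m\<rfloor> \<le> t * m" "t * m < of_int \<lfloor>t * m\<rfloor> + 1"
    using assms by auto
  have "real (m - uniform_cut t m) = m - (of_int \<lfloor>t * m\<rfloor> + 1)" if "m > 0"
  proof -
    \<comment> \<open>A cut never exceeds a nonempty rod, so truncated subtraction is exact. For
      \<open>m = 0\<close> it yields 0, which meets both bounds.\<close>
    have "t * m < m" using that assms by simp
    then have "nat \<lfloor>t * m\<rfloor> < m" using f by linarith
    then show ?thesis using f by (simp add: uniform_cut_def of_nat_diff)
  qed
  then have "real (m - uniform_cut t m) = m - (of_int \<lfloor>t * m\<rfloor> + 1) \<or> m = 0" by blast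
  then show "real (m - uniform_cut t m) \<le> (1 - t) * m" "(1 - t) * m - 1 \<le> real (m - uniform_cut t m)"
    using f by (elim disjE; simp add: left_diff_distrib; linarith)+
qed

lemma uniform_cut_bounds:
  fixes t :: real and m :: nat
  assumes "0 \<le> t"
  shows "t * m \<le> uniform_cut t m" "real (uniform_cut t m) \<le> t * m + 1"
proof -
  have "0 \<le> \<lfloor>t * m\<rfloor>" using assms by simp
  then show "t * m \<le> uniform_cut t m" "real (uniform_cut t m) \<le> t * m + 1"
    unfolding uniform_cut_def by linarith+
qed

lemma norm_cis_diff_le: "norm (cis a - cis b) \<le> \<bar>a - b\<bar>"
proof -
  have "norm (cis a - cis b) = norm (cis b * (cis (a - b) - 1))"
    by (simp add: right_diff_distrib cis_mult)
  also have "\<dots> \<le> \<bar>a - b\<bar>"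
    using iexp_approx1[of "a - b" 0] by (simp add: norm_mult cis_conv_exp)
  finally show ?thesis .
qed

text \<open>Between \<open>x\<close> and \<open>y\<close>, both at least \<open>y - d\<close>, the
  logarithm has slope at most \<open>1 / (y - d)\<close>.\<close>

lemma abs_ln_diff_le:
  fixes x y :: real
  assumes "\<bar>x - y\<bar> \<le> d" "d < y"
  shows "\<bar>ln x - ln y\<bar> \<le> d / (y - d)"
proof -
  have pos: "0 < y - d" "y - d \<le> x" "0 < y" "0 < x" "y - d \<le> y" "0 \<le> d" using assms by linarith+
  have "ln x - ln y \<le> (x - y) / y"
    using pos by (simp add: ln_diff_le)
  also have "\<dots> \<le> d / (y - d)"
    using assms pos by (intro frac_le) auto
  finally have "ln x - ln y \<le> d / (y - d)" .
  moreover have "ln y - ln x \<le> (y - x) / x"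
    using pos by (simp add: ln_diff_le)
  moreover have "(y - x) / x \<le> d / (y - d)"
    using assms pos by (intro frac_le) auto
  ultimately show ?thesis by linarith
qed

text \<open>The cut 0 is possible but has probability 0. Excluding it makes
  \<open>u k * rest u k\<close> positive, so that its logarithm splits into a sum.\<close>

locale cut_sequence =
  fixes u :: "nat \<Rightarrow> real"
  assumes u: "0 < u k" "u k < 1"
begin

lemma rest_pos: "rest u k > 0"
  unfolding rest_def using u by (intro prod_pos) auto

lemma ln_rest_eq: "ln (rest u k) = (\<Sum>i<k. ln (1 - u i))"
  unfolding rest_def using less_imp_neq[OF u(2)] by (subst ln_prod) auto

lemma rod_le: "rod u n k \<le> n * rest u k"
proof (induction k)
  case (Suc k)
  have "rod u n (Suc k) \<le> (1 - u k) * rod u n k"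
    using real_diff_uniform_cut(1)[of "u k" "rod u n k"] u[of k] by simp
  also have "\<dots> \<le> (1 - u k) * (n * rest u k)"
    using Suc u[of k] by (intro mult_left_mono) auto
  finally show ?case by (simp add: rest_def mult_ac)
qed (simp add: rest_def)

text \<open>Each step adds a rounding loss of at most 1, and the loss inherited from earlier steps
  is multiplied by \<open>1 - u k\<close>, which is below 1; so losses accumulate at most
  linearly.\<close>

lemma rod_ge: "n * rest u k \<le> rod u n k + k"
proof (induction k)
  case (Suc k)
  have "n * rest u (Suc k) = (1 - u k) * (n * rest u k)"
    by (simp add: rest_def)
  also have "\<dots> \<le> (1 - u k) * (rod u n k + k)"
    using Suc u[of k] by (intro mult_left_mono) auto
  also have "\<dots> \<le> (1 - u k) * rod u n k + k"
    using u[of k] by (simp add: algebra_simps)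
  also have "\<dots> \<le> rod u n (Suc k) + Suc k"
    using real_diff_uniform_cut(2)[of "u k" "rod u n k"] u[of k] by simp
  finally show ?case .
qed (simp add: rest_def)

text \<open>The error of the rod, at most \<open>k\<close>, is scaled by \<open>u k < 1\<close>;
  rounding this cut contributes at most 1 more.\<close>

lemma dist_cut_le: "\<bar>uniform_cut (u k) (rod u n k) - n * (u k * rest u k)\<bar> \<le> real (k + 1)"
proof -
  have "u k * (n * rest u k) \<le> u k * real (rod u n k + k)"
    using u[of k] rod_ge by (intro mult_left_mono) (auto intro: less_imp_le)
  also have "\<dots> \<le> u k * real (rod u n k) + k"
    using u[of k] by (simp add: distrib_left mult_left_le_one_le less_imp_le)
  finally have "u k * (n * rest u k) \<le> u k * real (rod u n k) + k" .
  moreover have "u k * real (rod u n k) \<le> u k * (n * rest u k)"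
    using u[of k] rod_le by (intro mult_left_mono) (auto intro: less_imp_le)
  moreover have "n * (u k * rest u k) = u k * (n * rest u k)" by simp
  ultimately show ?thesis
    using uniform_cut_bounds[of "u k" "rod u n k"] u[of k] unfolding of_nat_add of_nat_1 by linarith
qed

end

text \<open>The two growth rates supplied almost surely by the law of large numbers. They refer to
  \<open>u\<close> alone and not to \<open>n\<close>, and all that follows in this locale is
  deterministic.\<close>

locale regular_cut_sequence = cut_sequence +
  assumes ln_rest: "(\<lambda>k. ln (rest u k) / k) \<longlonglongrightarrow> -1"
    and ln_cut: "(\<lambda>k. ln (u k) / k) \<longlonglongrightarrow> 0"
begin

abbreviation N :: "nat \<Rightarrow> nat" where "N n \<equiv> length (fragmentation_path u n)"

text \<open>Since \<open>ln (u k * rest u k)\<close> is \<open>- k + o(k)\<close>, the unrounded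
  piece still exceeds a fixed multiple of its error bound \<open>k + 1\<close> while
  \<open>k\<close> is below \<open>r * ln n\<close> with \<open>r < 1\<close>.\<close>

lemma early_pieces_large:
  assumes r: "0 < r" "r < 1" and "R > 0"
  shows "eventually (\<lambda>n. \<forall>k. real k < r * ln (real n) \<longrightarrow> R * real (k + 1) \<le> n * (u k * rest u k)) sequentially"
proof -
  \<comment> \<open>For \<open>n > 0\<close> the inequality to be proved is
    \<open>b k \<le> ln n\<close>.\<close>
  define b where "b k = ln (R * (real k + 1)) - ln (u k) - ln (rest u k)" for k
  have "(\<lambda>k. ln (R * (real k + 1)) / k) \<longlonglongrightarrow> 0"
    using \<open>R > 0\<close> by real_asymp
  then have "(\<lambda>k. ln (R * (real k + 1)) / k - ln (u k) / k - ln (rest u k) / k) \<longlonglongrightarrow> 0 - 0 - (-1)"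
    by (intro tendsto_diff ln_rest ln_cut)
  then have "(\<lambda>k. b k / k) \<longlonglongrightarrow> 1"
    by (simp add: b_def diff_divide_distrib)
  moreover have "1 < 1 / r" using r by simp
  ultimately have "eventually (\<lambda>k. b k / k < 1 / r) sequentially"
    by (rule order_tendstoD(2))
  then obtain k0 where k0: "\<And>k. k \<ge> k0 \<Longrightarrow> b k / k < 1 / r"
    by (auto simp: eventually_sequentially)
  \<comment> \<open>The finitely many \<open>k\<close> that the limit does not control only require
    \<open>ln n\<close> to exceed a constant.\<close>
  define C where "C = Max (b ` {..k0})"
  have "filterlim (\<lambda>n. ln (real n)) at_top sequentially" by real_asymp
  then have "eventually (\<lambda>n. C \<le> ln (real n)) sequentially"
    by (simp add: filterlim_at_top)
  then show ?thesis using eventually_gt_at_top[of 0]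
  proof eventually_elim
    case (elim n)
    show ?case
    proof (intro allI impI)
      fix k assume k: "real k < r * ln (real n)"
      have "b k \<le> ln n"
      proof (cases "k \<le> k0")
        case True
        then have "b k \<le> C" unfolding C_def by (intro Max_ge) auto
        with elim show ?thesis by simp
      next
        case False
        with k0[of k] have "b k < k / r" by (simp add: field_simps)
        also have "\<dots> < ln n" using k r by (simp add: field_simps)
        finally show ?thesis by simp
      qed
      then have "ln (R * (real k + 1)) \<le> ln (n * (u k * rest u k))"
        using u[of k] rest_pos[of k] elim by (simp add: b_def ln_mult)
      moreover have "0 < R * (real k + 1)" "0 < n * (u k * rest u k)"
        using u[of k] rest_pos[of k] elim \<open>R > 0\<close> by simp_all
      ultimately show "R * real (k + 1) \<le> n * (u k * rest u k)"
        by (simp add: add.commute)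
    qed
  qed
qed

text \<open>At \<open>k = N n\<close> the rod is used up, so \<open>rod_ge\<close> gives
  \<open>n * rest u k \<le> k\<close>. If \<open>k\<close> were below \<open>r * ln n\<close>, the
  previous lemma with \<open>R = 1\<close> would force this quantity to be at least
  \<open>k + 1\<close>.\<close>

lemma length_ge:
  assumes r: "0 < r" "r < 1"
  shows "eventually (\<lambda>n. r * ln n \<le> N n) sequentially"
  using early_pieces_large[OF r zero_less_one]
proof eventually_elim
  case (elim n)
  show ?case
  proof (rule ccontr)
    assume "\<not> r * ln n \<le> N n"
    then have "real (N n) + 1 \<le> n * (u (N n) * rest u (N n))" using elim by (simp add: add.commute)
    also have "\<dots> \<le> n * rest u (N n)"
      using u[of "N n"] rest_pos[of "N n"] by (intro mult_left_mono) auto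
    also have "\<dots> \<le> rod u n (N n) + N n" by (rule rod_ge)
    finally have "rod u n (N n) > 0" by simp
    then show False
      using length_fragmentation_path_gt_iff[of "N n" u n] by simp
  qed
qed

text \<open>After roughly \<open>c * ln n\<close> steps with \<open>c > 1\<close> the unrounded rod
  is shorter than 1; the actual rod is no longer and has integer length, hence is 0.\<close>

lemma length_le:
  assumes c: "c > 1"
  shows "eventually (\<lambda>n. N n \<le> c * ln n + 1) sequentially"
proof -
  have "-1 < - (1 / c)" using c by simp
  then have "eventually (\<lambda>k. ln (rest u k) / k < - (1 / c)) sequentially"
    using order_tendstoD(2)[OF ln_rest] by blast
  then obtain k0 where k0: "\<And>k. k \<ge> k0 \<Longrightarrow> ln (rest u k) / k < - (1 / c)"
    by (auto simp: eventually_sequentially)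
  have "filterlim (\<lambda>n. c * ln (real n)) at_top sequentially" using c by real_asymp
  then have "eventually (\<lambda>n. real (Suc k0) \<le> c * ln (real n)) sequentially"
    by (simp add: filterlim_at_top)
  then show ?thesis using eventually_gt_at_top[of 0]
  proof eventually_elim
    case (elim n)
    define k where "k = nat \<lceil>c * ln n\<rceil>"
    have k: "c * ln n \<le> k" "k \<le> c * ln n + 1" "k \<ge> k0" "k > 0"
      using elim unfolding k_def by linarith+
    have "ln (rest u k) < - (k / c)"
      using k0[OF k(3)] k(4) c by (simp add: field_simps)
    moreover have "ln n \<le> k / c" using k(1) c by (simp add: field_simps)
    ultimately have "ln (n * rest u k) < 0"
      using elim rest_pos[of k] by (simp add: ln_mult)
    then have "n * rest u k < 1"
      using elim rest_pos[of k] by simp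
    then have "rod u n k = 0" using rod_le[of n k] by linarith
    then have "N n \<le> k"
      using length_fragmentation_path_gt_iff[of k u n] by simp
    then show ?case using k(2) by linarith
  qed
qed

lemma length_at_top: "filterlim N at_top sequentially"
proof -
  have "filterlim (\<lambda>n. 1 / 2 * ln (real n)) at_top sequentially" by real_asymp
  then have "filterlim (\<lambda>n. real (N n)) at_top sequentially"
    by (rule filterlim_at_top_mono) (rule length_ge, auto)
  then show ?thesis by (simp add: filterlim_sequentially_iff_filterlim_real)
qed

text \<open>The steps are split at \<open>M\<close>, about \<open>(1 - e) * ln n\<close>. Before
  \<open>M\<close> the rounding error is relatively small, so each term changes by at most
  \<open>e\<close>; from \<open>M\<close> on there are at most \<open>2 * e * ln n + 1\<close>
  terms, each changing by at most 2.\<close>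

lemma list_mean_cis_ln:
  assumes mean: "(\<lambda>K. (\<Sum>k<K. cis (\<tau> * ln (u k * rest u k))) /\<^sub>R real K) \<longlonglongrightarrow> 0"
  shows "(\<lambda>n. list_mean (\<lambda>x. cis (\<tau> * ln (real x))) (fragmentation_path u n)) \<longlonglongrightarrow> 0"
proof (rule LIMSEQ_I)
  let ?X = "\<lambda>n k. real (uniform_cut (u k) (rod u n k))"
  let ?P = "\<lambda>n k. n * (u k * rest u k)"
  let ?D = "\<lambda>n k. cis (\<tau> * ln (?X n k)) - cis (\<tau> * ln (?P (real n) k))"
  fix e0 :: real assume "e0 > 0"
  \<comment> \<open>Replacing the pieces will cost \<open>9 * e\<close> and the assumed mean another
    \<open>e\<close>, so \<open>e0 / 11\<close> leaves room. The bound \<open>1 / 11\<close> ensures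
    \<open>3 / 4 \<le> 1 - e\<close>.\<close>
  define e where "e = min (e0 / 11) (1 / 11)"
  have e: "0 < e" "e < 1" "10 * e < e0" using \<open>e0 > 0\<close> by (auto simp: e_def min_def)
  \<comment> \<open>Chosen so that \<open>\<bar>\<tau>\<bar> / (R - 1) \<le> e\<close>, which bounds
    the change of phase before \<open>M\<close>.\<close>
  define R where "R = 2 + \<bar>\<tau>\<bar> / e"
  have R: "R > 1" using e by (simp add: R_def add_pos_nonneg)
  have r: "0 < 1 - e" "1 - e < 1" using e by auto
  have "filterlim (\<lambda>n. ln (real n)) at_top sequentially" by real_asymp
  then have ev_ln: "eventually (\<lambda>n. 1 / e \<le> ln (real n)) sequentially"
    by (simp add: filterlim_at_top)
  have "(\<lambda>n. (\<Sum>k<N n. cis (\<tau> * ln (u k * rest u k))) /\<^sub>R real (N n)) \<longlonglongrightarrow> 0"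
    by (rule filterlim_compose[OF mean length_at_top])
  then have "eventually (\<lambda>n. norm ((\<Sum>k<N n. cis (\<tau> * ln (u k * rest u k))) /\<^sub>R real (N n)) < e) sequentially"
    using order_tendstoD(2)[OF tendsto_norm_zero e(1)] by blast
  moreover have "eventually (\<lambda>n. \<forall>k. real k < (1 - e) * ln (real n) \<longrightarrow> R * real (k + 1) \<le> ?P n k) sequentially"
    using R by (intro early_pieces_large r) simp
  moreover have "eventually (\<lambda>n. (1 - e) * ln n \<le> N n) sequentially"
    by (rule length_ge[OF r])
  moreover have "eventually (\<lambda>n. N n \<le> (1 + e) * ln n + 1) sequentially"
    using e by (intro length_le) simp
  ultimately have "eventually (\<lambda>n. norm (list_mean (\<lambda>x. cis (\<tau> * ln (real x))) (fragmentation_path u n)) < e0) sequentially"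
    using ev_ln eventually_gt_at_top[of 0]
  proof eventually_elim
    case (elim n)
    define l where "l = ln (real n)"
    define M where "M = nat \<lceil>(1 - e) * l\<rceil>"
    have l: "1 / e \<le> l" "1 \<le> e * l" "0 < l"
    proof -
      show *: "1 / e \<le> l" using elim by (simp add: l_def)
      show "1 \<le> e * l" using * e by (simp add: field_simps)
      show "0 < l" using * e by (meson less_le_trans zero_less_divide_1_iff)
    qed
    have "0 < (1 - e) * l" using e l by simp
    then have M: "(1 - e) * l \<le> M" "M \<le> N n" "\<And>k. k < M \<Longrightarrow> k < (1 - e) * l"
      using elim(3) unfolding M_def l_def by linarith+
    have Npos: "N n > 0" using M \<open>0 < (1 - e) * l\<close> by linarith
    have close: "norm (?D n k) \<le> e" if "k < M" for k
    proof -
      have large: "R * real (k + 1) \<le> ?P (real n) k" using elim(2) M(3)[OF that] by (simp add: l_def)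
      moreover have "1 * real (k + 1) < R * real (k + 1)"
        using R by (intro mult_strict_right_mono) auto
      ultimately have k: "real (k + 1) < ?P (real n) k" by (simp only: mult_1 less_le_trans)
      have "norm (?D n k) \<le> \<bar>\<tau> * ln (?X n k) - \<tau> * ln (?P (real n) k)\<bar>"
        by (rule norm_cis_diff_le)
      also have "\<dots> = \<bar>\<tau>\<bar> * \<bar>ln (?X n k) - ln (?P (real n) k)\<bar>"
        by (simp add: right_diff_distrib flip: abs_mult)
      also have "\<bar>ln (?X n k) - ln (?P (real n) k)\<bar> \<le> real (k + 1) / (?P (real n) k - real (k + 1))"
        by (intro abs_ln_diff_le dist_cut_le k)
      also have "\<dots> \<le> real (k + 1) / ((R - 1) * real (k + 1))"
        using large k R by (intro divide_left_mono mult_pos_pos) (auto simp: left_diff_distrib)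
      also have "\<dots> = 1 / (R - 1)" by simp
      also have "\<bar>\<tau>\<bar> * (1 / (R - 1)) \<le> e"
        using e by (simp add: R_def field_simps)
      finally show ?thesis by (simp add: mult_left_mono)
    qed
    have "norm (\<Sum>k<N n. ?D n k) \<le> (\<Sum>k<N n. norm (?D n k))" by (rule norm_sum)
    also have "\<dots> = (\<Sum>k<M. norm (?D n k)) + (\<Sum>k\<in>{M..<N n}. norm (?D n k))"
      unfolding lessThan_atLeast0 using M by (intro sum.atLeastLessThan_concat[symmetric]) auto
    also have "\<dots> \<le> (\<Sum>k<M. e) + (\<Sum>k\<in>{M..<N n}. 2)"
    proof (intro add_mono sum_mono)
      show "norm (?D n k) \<le> 2" for k
        using norm_triangle_ineq4[of "cis (\<tau> * ln (?X n k))" "cis (\<tau> * ln (?P (real n) k))"] by simp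
    qed (use close in auto)
    also have "\<dots> = e * M + 2 * (real (N n) - real M)" using M by (simp add: of_nat_diff)
    also have "\<dots> \<le> e * N n + 2 * (2 * e * l + 1)"
    proof (rule add_mono)
      show "e * M \<le> e * N n" using e M by simp
      show "2 * (real (N n) - real M) \<le> 2 * (2 * e * l + 1)"
        using M(1) elim(4) by (simp add: l_def algebra_simps)
    qed
    \<comment> \<open>The rounding term 1 is absorbed because \<open>1 \<le> e * l\<close> for large
      \<open>n\<close>.\<close>
    also have "2 * e * l + 1 \<le> 3 * e * l" using l by simp
    also have "\<dots> \<le> 4 * e * ((1 - e) * l)"
    proof -
      have "3 / 4 * (e * l) \<le> (1 - e) * (e * l)"
        using e l by (intro mult_right_mono) (auto simp: e_def min_def)
      then show ?thesis by (simp add: algebra_simps)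
    qed
    also have "\<dots> \<le> 4 * e * N n"
      using elim(3) e by (intro mult_left_mono) (auto simp: l_def)
    finally have D: "norm (\<Sum>k<N n. ?D n k) \<le> 9 * e * N n" by simp
    \<comment> \<open>The factor \<open>n\<close> contributes a rotation common to all
      \<open>k\<close>, which leaves the norm of the sum unchanged.\<close>
    have "cis (\<tau> * ln (?P (real n) k)) = cis (\<tau> * l) * cis (\<tau> * ln (u k * rest u k))" for k
      using elim u[of k] rest_pos[of k]
      by (simp add: l_def ln_mult cis_mult distrib_left)
    then have "(\<Sum>k<N n. cis (\<tau> * ln (?X n k))) =
        (\<Sum>k<N n. ?D n k) + cis (\<tau> * l) * (\<Sum>k<N n. cis (\<tau> * ln (u k * rest u k)))"
      by (simp add: sum_subtractf sum_distrib_left)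
    then have "norm (\<Sum>k<N n. cis (\<tau> * ln (?X n k))) \<le>
        9 * e * N n + norm (\<Sum>k<N n. cis (\<tau> * ln (u k * rest u k)))"
      using D by (auto intro!: norm_triangle_mono simp: norm_mult)
    also have "\<dots> < 9 * e * N n + e * N n"
      using elim(1) Npos by (simp add: field_simps)
    also have "\<dots> \<le> e0 * N n"
      using e Npos by (simp flip: distrib_right)
    finally show ?case
      using Npos by (simp add: list_mean_fragmentation_path field_simps)
  qed
  then show "\<exists>N0. \<forall>n\<ge>N0. norm (list_mean (\<lambda>x. cis (\<tau> * ln (real x))) (fragmentation_path u n) - 0) < e0"
    by (simp add: eventually_sequentially)
qed

text \<open>The character of frequency \<open>h\<close>, evaluated at \<open>log 10 x\<close>, is
  \<open>cis (\<tau> * ln x)\<close> with \<open>\<tau> = 2 * pi * h / ln 10\<close>. Weyl's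
  criterion then gives equidistribution of the logarithms, which is the claim about
  significands.\<close>

theorem converges_to_strong_Benford_path:
  assumes mean: "\<And>h::int. h \<noteq> (0::int) \<Longrightarrow>
    (\<lambda>K. (\<Sum>k<K. cis (2 * pi * h / ln 10 * ln (u k * rest u k))) /\<^sub>R real K) \<longlonglongrightarrow> 0"
  shows "converges_to_strong_Benford (\<lambda>n. fragmentation_path u n)"
  unfolding converges_to_strong_Benford_def
proof (intro allI impI)
  fix s :: real assume s: "1 \<le> s \<and> s < 10"
  let ?L = "\<lambda>n. map (\<lambda>x. log 10 (real x)) (fragmentation_path u n)"
  have "(\<lambda>n. list_mean (\<lambda>y. of_bool (frac y \<le> log 10 s)) (?L n)) \<longlonglongrightarrow> log 10 s"
  proof (rule weyl_criterion)
    have "eventually (\<lambda>n. N n > 0) sequentially"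
      by (rule eventually_compose_filterlim[OF eventually_gt_at_top length_at_top])
    then show "eventually (\<lambda>n. ?L n \<noteq> []) sequentially" by (rule eventually_mono) auto
    fix h :: int assume "h \<noteq> 0"
    from list_mean_cis_ln[OF mean[OF this]]
    show "(\<lambda>n. list_mean (\<lambda>x. cis (2 * pi * (real_of_int h * x))) (?L n)) \<longlonglongrightarrow> 0"
      by (simp add: list_mean_map log_def mult.assoc)
  qed (use s in \<open>auto simp: log_less_iff\<close>)
  moreover have "list_mean (\<lambda>y. of_bool (frac y \<le> log 10 s)) (?L n) = significand_proportion (fragmentation_path u n) s" for n
  proof -
    have "frac (log 10 (real x)) \<le> log 10 s \<longleftrightarrow> significand10 (real x) \<le> s" if x: "x \<in> set (fragmentation_path u n)" for x
    proof -
      obtain k where "k < N n" "x = fragmentation_path u n ! k"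
        using x by (auto simp: in_set_conv_nth)
      then have "x > 0" by (simp add: nth_fragmentation_path uniform_cut_def)
      then show ?thesis using s by (simp add: significand10_le_iff)
    qed
    then show ?thesis
      unfolding significand_proportion_def list_mean_of_bool[symmetric] list_mean_map
      by (intro list_mean_cong) simp
  qed
  ultimately show "(\<lambda>n. significand_proportion (fragmentation_path u n) s) \<longlonglongrightarrow> log 10 s"
    by simp
qed

end

section \<open>Almost sure convergence of means\<close>

lemma floor_sqrt_at_top: "filterlim floor_sqrt at_top sequentially"
  unfolding filterlim_at_top eventually_sequentially
  by (meson le_floor_sqrt_iff order_trans)

text \<open>For \<open>K\<close> from \<open>m\<^sup>2\<close> up to but excluding
  \<open>(Suc m)\<^sup>2\<close>, at most \<open>2 * m\<close> further terms of norm at most 1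
  occur; after division by at least \<open>m\<^sup>2\<close> they contribute at most
  \<open>2 / m\<close>.\<close>

lemma mean_tendsto_from_squares_bounded:
  fixes z :: "nat \<Rightarrow> complex"
  assumes z: "\<And>k. norm (z k) \<le> 1"
  assumes sq: "(\<lambda>m. (\<Sum>k<m\<^sup>2. z k) /\<^sub>R real (m\<^sup>2)) \<longlonglongrightarrow> 0"
  shows "(\<lambda>K. (\<Sum>k<K. z k) /\<^sub>R real K) \<longlonglongrightarrow> 0"
proof (rule Lim_null_comparison)
  define b where "b m = norm ((\<Sum>k<m\<^sup>2. z k) /\<^sub>R real (m\<^sup>2)) + 2 / real m" for m
  have "(\<lambda>m. 2 / real m) \<longlonglongrightarrow> 0" by real_asymp
  then have "b \<longlonglongrightarrow> 0"
    unfolding b_def using tendsto_norm_zero[OF sq] tendsto_add by fastforce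
  then show "(\<lambda>K. b (floor_sqrt K)) \<longlonglongrightarrow> 0"
    by (rule filterlim_compose[OF _ floor_sqrt_at_top])
  show "eventually (\<lambda>K. norm ((\<Sum>k<K. z k) /\<^sub>R real K) \<le> b (floor_sqrt K)) sequentially"
    using eventually_gt_at_top[of 0]
  proof eventually_elim
    case (elim K)
    define m where "m = floor_sqrt K"
    have m: "m\<^sup>2 \<le> K" "K < (Suc m)\<^sup>2" "m > 0"
      using elim Suc_floor_sqrt_power2_gt by (auto simp: m_def)
    have "(\<Sum>k<K. z k) = (\<Sum>k<m\<^sup>2. z k) + (\<Sum>k\<in>{m\<^sup>2..<K}. z k)"
      unfolding lessThan_atLeast0 using m by (intro sum.atLeastLessThan_concat[symmetric]) auto
    moreover have "norm (\<Sum>k\<in>{m\<^sup>2..<K}. z k) \<le> real (card {m\<^sup>2..<K}) * 1"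
      by (rule sum_norm_bound) (rule z)
    moreover have "card {m\<^sup>2..<K} \<le> 2 * m"
      using m by (simp add: power2_eq_square)
    then have "real (card {m\<^sup>2..<K}) \<le> 2 * real m" by linarith
    ultimately have le: "norm (\<Sum>k<K. z k) \<le> norm (\<Sum>k<m\<^sup>2. z k) + 2 * real m"
      by (auto intro!: norm_triangle_mono elim: order_trans)
    have "norm ((\<Sum>k<K. z k) /\<^sub>R real K) = norm (\<Sum>k<K. z k) / K"
      by (simp add: divide_inverse mult.commute)
    also have "\<dots> \<le> (norm (\<Sum>k<m\<^sup>2. z k) + 2 * real m) / (real m)\<^sup>2"
    proof (rule frac_le)
      show "(real m)\<^sup>2 \<le> real K" using m(1) by (metis of_nat_le_iff of_nat_power)
    qed (use le m in auto)
    also have "\<dots> = b m"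
      using m by (simp add: b_def field_simps power2_eq_square)
    finally show ?case by (simp add: m_def)
  qed
qed

text \<open>Monotone partial sums trap the mean at \<open>K\<close> between those at neighbouring
  squares, up to factors tending to 1. This version allows unbounded terms, as needed for
  exponential variables.\<close>

lemma mean_tendsto_from_squares_nonneg:
  fixes x :: "nat \<Rightarrow> real"
  assumes x: "\<And>k. x k \<ge> 0"
  assumes sq: "(\<lambda>m. (\<Sum>k<m\<^sup>2. x k) / real (m\<^sup>2)) \<longlonglongrightarrow> \<mu>"
  shows "(\<lambda>K. (\<Sum>k<K. x k) / real K) \<longlonglongrightarrow> \<mu>"
proof -
  define T where "T K = (\<Sum>k<K. x k)" for K
  define a where "a m = T (m\<^sup>2) / real (m\<^sup>2)" for m
  have T_mono: "T i \<le> T j" if "i \<le> j" for i j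
    unfolding T_def using that x by (intro sum_mono2) auto
  have T_nonneg: "T i \<ge> 0" for i unfolding T_def using x by (simp add: sum_nonneg)
  have a: "a \<longlonglongrightarrow> \<mu>" using sq unfolding a_def T_def .
  have "(\<lambda>m. (real m)\<^sup>2 / (real (Suc m))\<^sup>2) \<longlonglongrightarrow> 1" "(\<lambda>m. (real (Suc m))\<^sup>2 / (real m)\<^sup>2) \<longlonglongrightarrow> 1"
    by real_asymp+
  from tendsto_mult[OF a this(1)] tendsto_mult[OF LIMSEQ_Suc[OF a] this(2)]
  have lim: "(\<lambda>m. a m * ((real m)\<^sup>2 / (real (Suc m))\<^sup>2)) \<longlonglongrightarrow> \<mu>"
    "(\<lambda>m. a (Suc m) * ((real (Suc m))\<^sup>2 / (real m)\<^sup>2)) \<longlonglongrightarrow> \<mu>" by simp_all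
  have ev: "eventually (\<lambda>K. a (floor_sqrt K) * ((real (floor_sqrt K))\<^sup>2 / (real (Suc (floor_sqrt K)))\<^sup>2) \<le> T K / real K \<and>
      T K / real K \<le> a (Suc (floor_sqrt K)) * ((real (Suc (floor_sqrt K)))\<^sup>2 / (real (floor_sqrt K))\<^sup>2)) sequentially"
    using eventually_gt_at_top[of 0]
  proof eventually_elim
    case (elim K)
    define m where "m = floor_sqrt K"
    have m: "m\<^sup>2 \<le> K" "K < (Suc m)\<^sup>2" "m > 0"
      using elim Suc_floor_sqrt_power2_gt by (auto simp: m_def)
    have m': "(real m)\<^sup>2 \<le> real K" "real K \<le> (real (Suc m))\<^sup>2"
      using m(1,2) by (metis of_nat_le_iff of_nat_power less_imp_le)+
    have "a m * ((real m)\<^sup>2 / (real (Suc m))\<^sup>2) = T (m\<^sup>2) / (real (Suc m))\<^sup>2"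
      using m by (simp add: a_def)
    also have "\<dots> \<le> T K / K"
      using m m' elim by (intro frac_le T_mono T_nonneg) auto
    finally have 1: "a m * ((real m)\<^sup>2 / (real (Suc m))\<^sup>2) \<le> T K / K" .
    have "T K / K \<le> T ((Suc m)\<^sup>2) / (real m)\<^sup>2"
      using m m' elim by (intro frac_le T_mono T_nonneg) auto
    also have "\<dots> = a (Suc m) * ((real (Suc m))\<^sup>2 / (real m)\<^sup>2)"
      by (simp add: a_def del: of_nat_Suc)
    finally show ?case using 1 by (simp only: m_def conj_absorb)
  qed
  have "(\<lambda>K. T K / real K) \<longlonglongrightarrow> \<mu>"
    by (rule tendsto_sandwich[OF _ _ filterlim_compose[OF lim(1) floor_sqrt_at_top] filterlim_compose[OF lim(2) floor_sqrt_at_top]])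
       (use ev in \<open>auto elim: eventually_mono\<close>)
  then show ?thesis by (simp add: T_def)
qed

lemma sum_geometric_inj_le:
  fixes r :: real
  assumes "0 \<le> r" "r < 1" "inj_on f A" "finite A"
  shows "(\<Sum>a\<in>A. r ^ f a) \<le> 1 / (1 - r)"
proof -
  have "(\<Sum>a\<in>A. r ^ f a) = (\<Sum>i\<in>f ` A. r ^ i)"
    using assms by (simp add: sum.reindex)
  also have "\<dots> \<le> (\<Sum>i. r ^ i)"
    using assms by (intro sum_le_suminf summable_geometric) auto
  finally show ?thesis using assms by (simp add: suminf_geometric)
qed

section \<open>Second moment bounds\<close>

context prob_space
begin

text \<open>At the index \<open>m\<^sup>2\<close> the squared mean has expectation at most
  \<open>C / m\<^sup>2\<close>, which is summable in \<open>m\<close>. Hence the series of squared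
  means is almost surely finite and its terms tend to 0.\<close>

lemma AE_squares_mean_tendsto_0:
  fixes Z :: "nat \<Rightarrow> 'a \<Rightarrow> complex"
  assumes [measurable]: "\<And>k. Z k \<in> borel_measurable M"
  assumes bound: "\<And>K. (\<integral>\<^sup>+\<omega>. ennreal ((norm (\<Sum>k<K. Z k \<omega>))\<^sup>2) \<partial>M) \<le> ennreal (C * real K)"
  assumes C: "C \<ge> 0"
  shows "AE \<omega> in M. (\<lambda>m. (\<Sum>k<m\<^sup>2. Z k \<omega>) /\<^sub>R real (m\<^sup>2)) \<longlonglongrightarrow> 0"
proof -
  define f where "f m \<omega> = (norm ((\<Sum>k<m\<^sup>2. Z k \<omega>) /\<^sub>R real (m\<^sup>2)))\<^sup>2" for m \<omega>
  have [measurable]: "f m \<in> borel_measurable M" for m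
    unfolding f_def by measurable
  have f_le: "(\<integral>\<^sup>+\<omega>. ennreal (f m \<omega>) \<partial>M) \<le> ennreal (C / real (m\<^sup>2))" for m
  proof (cases "m = 0")
    case False
    have "(\<integral>\<^sup>+\<omega>. ennreal (f m \<omega>) \<partial>M) = (\<integral>\<^sup>+\<omega>. ennreal ((1 / real (m\<^sup>2))\<^sup>2) * ennreal ((norm (\<Sum>k<m\<^sup>2. Z k \<omega>))\<^sup>2) \<partial>M)"
      by (intro nn_integral_cong)
         (simp add: f_def power_mult_distrib power_divide divide_inverse flip: ennreal_mult')
    also have "\<dots> = ennreal ((1 / real (m\<^sup>2))\<^sup>2) * (\<integral>\<^sup>+\<omega>. ennreal ((norm (\<Sum>k<m\<^sup>2. Z k \<omega>))\<^sup>2) \<partial>M)"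
      by (rule nn_integral_cmult) measurable
    also have "\<dots> \<le> ennreal ((1 / real (m\<^sup>2))\<^sup>2) * ennreal (C * real (m\<^sup>2))"
      by (intro mult_left_mono bound) auto
    also have "\<dots> = ennreal (C / real (m\<^sup>2))"
      using False C by (simp add: field_simps power2_eq_square flip: ennreal_mult')
    finally show ?thesis .
  qed (simp add: f_def)
  have "summable (\<lambda>m. C * inverse (real m ^ 2))"
    by (intro summable_mult inverse_power_summable) simp
  then have sC: "summable (\<lambda>m. C / real (m\<^sup>2))"
    by (simp add: divide_inverse)
  have "(\<integral>\<^sup>+\<omega>. (\<Sum>m. ennreal (f m \<omega>)) \<partial>M) = (\<Sum>m. \<integral>\<^sup>+\<omega>. ennreal (f m \<omega>) \<partial>M)"
    by (rule nn_integral_suminf) measurable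
  also have "\<dots> \<le> (\<Sum>m. ennreal (C / real (m\<^sup>2)))"
    by (intro suminf_le f_le summableI)
  also have "\<dots> = ennreal (\<Sum>m. C / real (m\<^sup>2))"
    using sC C by (intro suminf_ennreal2) auto
  also have "\<dots> < \<infinity>" by simp
  finally have "(\<integral>\<^sup>+\<omega>. (\<Sum>m. ennreal (f m \<omega>)) \<partial>M) \<noteq> \<infinity>" by simp
  then have "AE \<omega> in M. (\<Sum>m. ennreal (f m \<omega>)) \<noteq> \<infinity>"
    by (intro nn_integral_noteq_infinite) auto
  then show ?thesis
  proof eventually_elim
    case (elim \<omega>)
    have "summable (\<lambda>m. f m \<omega>)"
      using elim by (intro summable_suminf_not_top) (auto simp: f_def)
    then have "(\<lambda>m. sqrt (f m \<omega>)) \<longlonglongrightarrow> sqrt 0"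
      by (intro tendsto_real_sqrt summable_LIMSEQ_zero)
    then show ?case
      unfolding f_def real_sqrt_abs abs_norm_cancel real_sqrt_zero by (rule tendsto_norm_zero_cancel)
  qed
qed

text \<open>The squared norm expands into a double sum of correlations; geometric decay bounds each
  row by a constant, so the total grows only linearly in \<open>K\<close>.\<close>

lemma nn_integral_norm_sum_sq_le:
  fixes Z :: "nat \<Rightarrow> 'a \<Rightarrow> complex"
  assumes int: "\<And>j k. integrable M (\<lambda>\<omega>. Z k \<omega> * cnj (Z j \<omega>))"
  assumes corr: "\<And>j k. j \<le> k \<Longrightarrow> norm (expectation (\<lambda>\<omega>. Z k \<omega> * cnj (Z j \<omega>))) \<le> c * r ^ (k - j)"
  assumes r: "0 \<le> r" "r < 1" and c: "c \<ge> 0"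
  shows "(\<integral>\<^sup>+\<omega>. ennreal ((norm (\<Sum>k<K. Z k \<omega>))\<^sup>2) \<partial>M) \<le> ennreal (2 * c / (1 - r) * K)"
proof -
  \<comment> \<open>With truncated subtraction, \<open>(k - j) + (j - k)\<close> is the distance of
    \<open>j\<close> and \<open>k\<close>. Conjugation exchanges the two indices.\<close>
  have corr': "norm (expectation (\<lambda>\<omega>. Z k \<omega> * cnj (Z j \<omega>))) \<le> c * r ^ ((k - j) + (j - k))" for j k
  proof (cases "j \<le> k")
    case False
    have "expectation (\<lambda>\<omega>. Z k \<omega> * cnj (Z j \<omega>)) = expectation (\<lambda>\<omega>. cnj (Z j \<omega> * cnj (Z k \<omega>)))"
      by (simp add: mult.commute)
    also have "\<dots> = cnj (expectation (\<lambda>\<omega>. Z j \<omega> * cnj (Z k \<omega>)))"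
      by (rule Bochner_Integration.integral_cnj)
    finally show ?thesis using corr[of k j] False by simp
  qed (use corr in simp)
  have sq: "complex_of_real ((norm (\<Sum>k<K. Z k \<omega>))\<^sup>2) = (\<Sum>k<K. \<Sum>j<K. Z k \<omega> * cnj (Z j \<omega>))" for \<omega>
    unfolding complex_norm_square cnj_sum sum_product by (rule refl)
  have int': "integrable M (\<lambda>\<omega>. \<Sum>k<K. \<Sum>j<K. Z k \<omega> * cnj (Z j \<omega>))"
    by (intro Bochner_Integration.integrable_sum int)
  then have i: "integrable M (\<lambda>\<omega>. (norm (\<Sum>k<K. Z k \<omega>))\<^sup>2)"
    unfolding sq[symmetric] by (simp only: complex_of_real_integrable_eq)
  have row: "(\<Sum>j<K. r ^ ((k - j) + (j - k))) \<le> 2 / (1 - r)" for k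
  proof -
    \<comment> \<open>On either side of \<open>k\<close> the exponent is injective in
      \<open>j\<close>, so each half is dominated by a full geometric series.\<close>
    have "(\<Sum>j<K. r ^ ((k - j) + (j - k))) =
        (\<Sum>j\<in>{..<K} \<inter> {j. j \<le> k}. r ^ ((k - j) + (j - k))) + (\<Sum>j\<in>{..<K} \<inter> - {j. j \<le> k}. r ^ ((k - j) + (j - k)))"
      by (rule sum.Int_Diff[of _ _ "{j. j \<le> k}", simplified Diff_eq]) simp
    also have "\<dots> \<le> 1 / (1 - r) + 1 / (1 - r)"
      by (intro add_mono sum_geometric_inj_le r) (auto simp: inj_on_def)
    finally show ?thesis by simp
  qed
  have "complex_of_real (expectation (\<lambda>\<omega>. (norm (\<Sum>k<K. Z k \<omega>))\<^sup>2)) = expectation (\<lambda>\<omega>. \<Sum>k<K. \<Sum>j<K. Z k \<omega> * cnj (Z j \<omega>))"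
    by (simp only: sq integral_complex_of_real[symmetric])
  also have "\<dots> = (\<Sum>k<K. \<Sum>j<K. expectation (\<lambda>\<omega>. Z k \<omega> * cnj (Z j \<omega>)))"
    by (simp add: Bochner_Integration.integral_sum Bochner_Integration.integrable_sum int)
  finally have "\<bar>expectation (\<lambda>\<omega>. (norm (\<Sum>k<K. Z k \<omega>))\<^sup>2)\<bar> = norm (\<Sum>k<K. \<Sum>j<K. expectation (\<lambda>\<omega>. Z k \<omega> * cnj (Z j \<omega>)))"
    by (simp only: norm_of_real[symmetric, where 'a = complex])
  also have "\<dots> \<le> (\<Sum>k<K. \<Sum>j<K. c * r ^ ((k - j) + (j - k)))"
    by (intro sum_norm_le corr')
  also have "\<dots> \<le> (\<Sum>k<K. c * (2 / (1 - r)))"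
    unfolding sum_distrib_left[symmetric] by (intro sum_mono mult_left_mono row c)
  also have "\<dots> = 2 * c / (1 - r) * K" by simp
  finally show ?thesis
    by (subst nn_integral_eq_integral[OF i]) (auto intro!: ennreal_leI)
qed

end

section \<open>Independent uniform cuts\<close>

interpretation iid_uniform: prob_space iid_uniform
  unfolding iid_uniform_def by (rule iid.P.prob_space_axioms)

lemma sets_iid_uniform [measurable_cong]: "sets iid_uniform = sets (\<Pi>\<^sub>M k\<in>UNIV. borel)"
  unfolding iid_uniform_def by (intro sets_PiM_cong) auto

lemma space_iid_uniform [simp]: "space iid_uniform = UNIV"
  by (simp add: iid_uniform_def space_PiM)

lemma measurable_coordinate [measurable]: "(\<lambda>u. u k) \<in> borel_measurable iid_uniform"
proof -
  have "(\<lambda>u. u k) \<in> (\<Pi>\<^sub>M k\<in>UNIV. borel) \<rightarrow>\<^sub>M borel"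
    by (rule measurable_component_singleton) simp
  then show ?thesis by (simp cong: measurable_cong_sets add: sets_iid_uniform)
qed

lemma measurable_cnj [measurable]: "cnj \<in> borel_measurable borel"
  by (intro borel_measurable_continuous_onI continuous_intros)

lemma measurable_cis [measurable]: "cis \<in> borel_measurable borel"
  by (intro borel_measurable_continuous_onI continuous_intros)

text \<open>Only finitely many coordinates are involved, so the integral is pushed forward to the
  finite product, where Fubini's theorem factorises it.\<close>

lemma
  fixes f :: "nat \<Rightarrow> real \<Rightarrow> 'b::{real_normed_field, banach, second_countable_topology}"
  assumes I: "finite I" and f: "\<And>i. i \<in> I \<Longrightarrow> integrable uniform01 (f i)"
  shows integral_prod_coordinates:
      "(\<integral>u. (\<Prod>i\<in>I. f i (u i)) \<partial>iid_uniform) = (\<Prod>i\<in>I. integral\<^sup>L uniform01 (f i))"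
    and integrable_prod_coordinates: "integrable iid_uniform (\<lambda>u. \<Prod>i\<in>I. f i (u i))"
proof -
  have d: "distr iid_uniform (PiM I (\<lambda>_. uniform01)) (\<lambda>u. restrict u I) = PiM I (\<lambda>_. uniform01)"
    unfolding iid_uniform_def using I by (intro iid.distr_PiM_restrict_finite) auto
  have r: "(\<lambda>u. restrict u I) \<in> iid_uniform \<rightarrow>\<^sub>M PiM I (\<lambda>_. uniform01)"
    unfolding iid_uniform_def by (rule measurable_restrict_subset) simp
  have int: "integrable (PiM I (\<lambda>_. uniform01)) (\<lambda>u. \<Prod>i\<in>I. f i (u i))"
    by (rule iid.product_integrable_prod[OF I f])
  have eq: "(\<Prod>i\<in>I. f i (restrict u I i)) = (\<Prod>i\<in>I. f i (u i))" for u
    by (rule prod.cong) auto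
  show "integrable iid_uniform (\<lambda>u. \<Prod>i\<in>I. f i (u i))"
    using integrable_distr[OF r, of "\<lambda>u. \<Prod>i\<in>I. f i (u i)"] int by (simp only: d eq)
  have "(\<integral>u. (\<Prod>i\<in>I. f i (u i)) \<partial>iid_uniform) = (\<integral>u. (\<Prod>i\<in>I. f i (u i)) \<partial>PiM I (\<lambda>_. uniform01))"
    using integral_distr[OF r borel_measurable_integrable[OF int]] by (simp only: d eq)
  also have "\<dots> = (\<Prod>i\<in>I. integral\<^sup>L uniform01 (f i))"
    by (rule iid.product_integral_prod[OF I f])
  finally show "(\<integral>u. (\<Prod>i\<in>I. f i (u i)) \<partial>iid_uniform) = (\<Prod>i\<in>I. integral\<^sup>L uniform01 (f i))" .
qed

lemma AE_uniform01_interior: "AE t in uniform01. t \<in> {0<..<1}"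
proof (rule AE_uniform_measureI)
  have "AE t in lborel. t \<noteq> (0::real)" by (rule AE_lborel_singleton)
  then show "AE t in lborel. t \<in> {0..<1} \<longrightarrow> t \<in> {0<..<(1::real)}"
    by eventually_elim auto
qed simp

lemma AE_iid_uniform_interior: "AE u in iid_uniform. \<forall>k. u k \<in> {0<..<1}"
  unfolding AE_all_countable iid_uniform_def
  using AE_uniform01_interior iid.M.prob_space_axioms by (intro allI AE_PiM_component) auto

text \<open>Reduces expectations to gauge integrals, to which the fundamental theorem of calculus
  applies. The endpoint 1, missing from the support, is a null set.\<close>

lemma integral_uniform01:
  fixes f :: "real \<Rightarrow> 'a::euclidean_space"
  assumes [measurable]: "f \<in> borel_measurable borel" and "\<And>x. norm (f x) \<le> B"
    and I: "(f has_integral I) {0..1}"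
  shows "(\<integral>t. f t \<partial>uniform01) = I"
proof -
  have "uniform01 = density lborel (\<lambda>x. ennreal (indicator {0..<1} x))"
    unfolding uniform_measure_def by (intro density_cong) (auto simp: divide_ennreal_def split: split_indicator)
  then have "(\<integral>t. f t \<partial>uniform01) = (LINT x : {0..<1} | lborel. f x)"
    by (simp add: integral_density set_lebesgue_integral_def)
  also have "\<dots> = (LINT x : {0..1} | lborel. f x)"
  proof (rule set_integral_cong_set)
    have "AE x in lborel. x \<noteq> (1::real)" by (rule AE_lborel_singleton)
    then show "AE x in lborel. (x \<in> {0..1::real}) = (x \<in> {0..<1})"
      by eventually_elim auto
  qed (auto simp: set_borel_measurable_def)
  also have "\<dots> = integral {0..1} f"
  proof (rule set_borel_integral_eq_integral(2))
    have "integrable lborel (\<lambda>x. indicator {0..1::real} x *\<^sub>R f x)"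
      using assms by (intro integrableI_bounded_set_indicator[where B = B]) auto
    then show "set_integrable lborel {0..1} f" by (simp add: set_integrable_def)
  qed
  finally show ?thesis using I by (simp add: integral_unique)
qed

text \<open>The integrand is \<open>(1 - t)\<close> to the power \<open>\<i> * \<tau>\<close>, with
  antiderivative \<open>F\<close>, namely \<open>- (1 - t)\<close> to the power
  \<open>1 + \<i> * \<tau>\<close>, divided by \<open>1 + \<i> * \<tau>\<close>, where the minus
  sign stands outside the power.\<close>

lemma integral_cis_ln:
  "(\<integral>t. cis (\<tau> * ln (1 - t)) \<partial>uniform01) = 1 / (1 + \<i> * \<tau>)"
proof (rule integral_uniform01[where B = 1])
  define w where "w = 1 + \<i> * \<tau>"
  have w: "w \<noteq> 0" by (simp add: w_def complex_eq_iff)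
  define F where "F t = - ((1 - t) *\<^sub>R cis (\<tau> * ln (1 - t)) / w)" for t :: real
  have "((\<lambda>t. cis (\<tau> * ln (1 - t))) has_integral (F 1 - F 0)) {0..1}"
  proof (rule fundamental_theorem_of_calculus_interior_strong[where S = "{}"])
    show deriv: "(F has_vector_derivative cis (\<tau> * ln (1 - t))) (at t)" if "t \<in> {0<..<1} - {}" for t
    proof -
      have t: "1 - t > 0" using that by simp
      then have "(1 - complex_of_real t) \<noteq> 0" by (simp add: complex_eq_iff)
      then have q: "(1 - complex_of_real t) * inverse (1 - complex_of_real t) = 1" by simp
      have "((\<lambda>t. (1 - t) *\<^sub>R cis (\<tau> * ln (1 - t))) has_vector_derivative - (w * cis (\<tau> * ln (1 - t)))) (at t)"
        unfolding has_vector_derivative_def using t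
        by (auto intro!: derivative_eq_intros ext simp: scaleR_conv_of_real w_def algebra_simps)
          (use q in algebra)
      from has_vector_derivative_minus[OF has_vector_derivative_divide[OF this, of w]] show ?thesis
        unfolding F_def using w by simp
    qed
    have "continuous (at t within {0..1}) F" if "t \<in> {0..1}" for t
    proof (cases "t = 1")
      case False
      then have "1 - t \<noteq> 0" by simp
      then show ?thesis
        unfolding F_def continuous_within
        by (auto intro!: tendsto_intros w)
    next
      case True
      \<comment> \<open>At 1 the phase oscillates without limit, but the factor \<open>1 - t\<close>
        forces \<open>F\<close> to 0.\<close>
      have "(F \<longlongrightarrow> 0) (at t within {0..1})"
      proof (rule Lim_null_comparison)
        show "eventually (\<lambda>t. norm (F t) \<le> \<bar>1 - t\<bar> / norm w) (at t within {0..1})"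
          by (simp add: F_def norm_divide)
        have "((\<lambda>t. \<bar>1 - t\<bar> / norm w) \<longlongrightarrow> \<bar>1 - t\<bar> / norm w) (at t within {0..1})"
          using w by (intro tendsto_intros) simp
        then show "((\<lambda>t. \<bar>1 - t\<bar> / norm w) \<longlongrightarrow> 0) (at t within {0..1})"
          using True by simp
      qed
      then show ?thesis using True by (simp add: continuous_within F_def)
    qed
    then show "continuous_on {0..1} F" by (simp add: continuous_on_eq_continuous_within)
  qed auto
  then show "((\<lambda>t. cis (\<tau> * ln (1 - t))) has_integral 1 / (1 + \<i> * \<tau>)) {0..1}"
    by (simp add: F_def w_def)
qed auto

text \<open>Inverse transform: \<open>t\<close> and \<open>1 - t\<close> are both uniform, so either
  negative logarithm is exponential. This supplies the moments for the law of large numbers.\<close>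

lemma distributed_ln_cut:
  assumes "X = (\<lambda>t. - ln t) \<or> X = (\<lambda>t. - ln (1 - t))"
  shows "distributed uniform01 lborel X (exponential_density 1)"
proof (rule exponential_distributedI)
  have X: "X \<in> borel_measurable borel"
    using assms by (elim disjE; hypsubst; measurable)
  then show "X \<in> borel_measurable uniform01"
    by (subst measurable_cong_sets[where M' = borel and N' = borel]) simp_all
  fix a :: real assume a: "0 \<le> a"
  define q where "q = exp (- a)"
  have q: "0 < q" "q \<le> 1" using a by (auto simp: q_def)
  have iff: "- ln t \<le> a \<longleftrightarrow> q \<le> t" if "t > 0" for t
    using that by (simp add: q_def minus_le_iff ln_ge_iff)
  have "emeasure lborel ({0..<1} \<inter> {t. X t \<le> a}) = ennreal (1 - q)"
    using assms
  proof
    assume X: "X = (\<lambda>t. - ln t)"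
    \<comment> \<open>The point 0 belongs to the event because \<open>ln 0 = 0\<close> by
      convention; it has measure 0.\<close>
    have "{0..<1} \<inter> {t. X t \<le> a} = {0} \<union> {q..<1}"
    proof (intro set_eqI)
      fix t show "t \<in> {0..<1} \<inter> {t. X t \<le> a} \<longleftrightarrow> t \<in> {0} \<union> {q..<1}"
        using a q iff[of t] by (cases "t = 0"; cases "t < 0") (auto simp: X)
    qed
    also have "emeasure lborel \<dots> = emeasure lborel {0::real} + emeasure lborel {q..<1}"
      using q by (subst plus_emeasure) auto
    finally show ?thesis using q by simp
  next
    assume X: "X = (\<lambda>t. - ln (1 - t))"
    have "{0..<1} \<inter> {t. X t \<le> a} = {0..1 - q}"
      using a q iff by (auto simp: X)
    then show ?thesis using q by simp
  qed
  moreover have "{t. X t \<le> a} \<in> sets borel" using X by measurable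
  ultimately show "emeasure uniform01 {t \<in> space uniform01. X t \<le> a} = 1 - ennreal (exp (- a * 1))"
    using q ennreal_minus[of q 1] by (simp add: q_def divide_ennreal_def)
qed simp

text \<open>A strong law from second moments: the centred variables are uncorrelated, which gives
  convergence along squares, and nonnegativity extends it to all indices.\<close>

lemma AE_mean_coordinates:
  fixes f :: "real \<Rightarrow> real"
  assumes int: "integrable uniform01 f" "integrable uniform01 (\<lambda>t. (f t)\<^sup>2)"
    and nonneg: "\<And>t. t \<in> {0<..<1} \<Longrightarrow> 0 \<le> f t"
  shows "AE u in iid_uniform. (\<lambda>K. (\<Sum>k<K. f (u k)) / real K) \<longlonglongrightarrow> iid.M.expectation f"
proof -
  define \<mu> where "\<mu> = iid.M.expectation f"
  define g where "g t = complex_of_real (f t - \<mu>)" for t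
  have [measurable]: "f \<in> borel_measurable borel"
    using borel_measurable_integrable[OF int(1)] by simp
  have g: "integrable uniform01 g" unfolding g_def using int by auto
  have "(\<lambda>t. (f t - \<mu>)\<^sup>2) = (\<lambda>t. (f t)\<^sup>2 - 2 * \<mu> * f t + \<mu>\<^sup>2)"
    by (simp add: power2_eq_square algebra_simps fun_eq_iff)
  then have "integrable uniform01 (\<lambda>t. (f t - \<mu>)\<^sup>2)"
    using int by auto
  moreover have "(\<lambda>t. g t * cnj (g t)) = (\<lambda>t. complex_of_real ((f t - \<mu>)\<^sup>2))"
    by (simp add: g_def power2_eq_square)
  ultimately have g2: "integrable uniform01 (\<lambda>t. g t * cnj (g t))"
    by (simp only: complex_of_real_integrable_eq)
  have Eg: "(\<integral>t. g t \<partial>uniform01) = 0"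
    using int by (simp add: g_def \<mu>_def iid.M.prob_space del: of_real_diff)
  define c where "c = norm (\<integral>t. g t * cnj (g t) \<partial>uniform01)"
  have same: "integrable iid_uniform (\<lambda>u. g (u k) * cnj (g (u k)))"
    "iid_uniform.expectation (\<lambda>u. g (u k) * cnj (g (u k))) = (\<integral>t. g t * cnj (g t) \<partial>uniform01)" for k
    using integrable_prod_coordinates[of "{k}" "\<lambda>_ t. g t * cnj (g t)"]
      integral_prod_coordinates[of "{k}" "\<lambda>_ t. g t * cnj (g t)"] g2 by simp_all
  have diff: "integrable iid_uniform (\<lambda>u. g (u k) * cnj (g (u j)))"
    "iid_uniform.expectation (\<lambda>u. g (u k) * cnj (g (u j))) = 0" if "j \<noteq> k" for j k
    using integrable_prod_coordinates[of "{k,j}" "\<lambda>_. g"] integral_prod_coordinates[of "{k,j}" "\<lambda>_. g"] g that Eg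
    by (simp_all add: g_def)
  have "AE u in iid_uniform. (\<lambda>m. (\<Sum>k<m\<^sup>2. g (u k)) /\<^sub>R real (m\<^sup>2)) \<longlonglongrightarrow> 0"
  proof (rule iid_uniform.AE_squares_mean_tendsto_0)
    \<comment> \<open>Ratio 0 encodes vanishing correlation: since \<open>0 ^ 0 = 1\<close>, the
      bound is \<open>c\<close> on the diagonal and 0 off it.\<close>
    show "(\<integral>\<^sup>+u. ennreal ((norm (\<Sum>k<K. g (u k)))\<^sup>2) \<partial>iid_uniform) \<le> ennreal (2 * c / (1 - 0) * K)" for K
    proof (rule iid_uniform.nn_integral_norm_sum_sq_le)
      show "integrable iid_uniform (\<lambda>u. g (u k) * cnj (g (u j)))" for j k
        using same diff by (cases "j = k") auto
      show "norm (iid_uniform.expectation (\<lambda>u. g (u k) * cnj (g (u j)))) \<le> c * 0 ^ (k - j)" if "j \<le> k" for j k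
        using same diff that by (cases "j = k") (auto simp: c_def)
    qed (auto simp: c_def)
    show "(\<lambda>u. g (u k)) \<in> borel_measurable iid_uniform" for k
      unfolding g_def by measurable
  qed (simp add: c_def)
  with AE_iid_uniform_interior show ?thesis
  proof eventually_elim
    case (elim u)
    have "(\<lambda>m. Re ((\<Sum>k<m\<^sup>2. g (u k)) /\<^sub>R real (m\<^sup>2)) + \<mu>) \<longlonglongrightarrow> Re 0 + \<mu>"
      by (intro tendsto_intros elim(2))
    then have "(\<lambda>m. (\<Sum>k<m\<^sup>2. f (u k)) / real (m\<^sup>2)) \<longlonglongrightarrow> Re 0 + \<mu>"
    proof (rule Lim_transform_eventually)
      show "eventually (\<lambda>m. Re ((\<Sum>k<m\<^sup>2. g (u k)) /\<^sub>R real (m\<^sup>2)) + \<mu> = (\<Sum>k<m\<^sup>2. f (u k)) / real (m\<^sup>2)) sequentially"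
        using eventually_gt_at_top[of 0]
        by eventually_elim (simp add: g_def sum_subtractf field_simps)
    qed
    then show ?case
      using elim(1) nonneg unfolding \<mu>_def
      by (intro mean_tendsto_from_squares_nonneg) auto
  qed
qed

lemma AE_mean_ln_cut:
  assumes X: "X = (\<lambda>t. - ln t) \<or> X = (\<lambda>t. - ln (1 - t))"
  shows "AE u in iid_uniform. (\<lambda>K. (\<Sum>k<K. X (u k)) / real K) \<longlonglongrightarrow> 1"
proof -
  note D = distributed_ln_cut[OF X]
  have "integrable uniform01 X" "integrable uniform01 (\<lambda>t. (X t)\<^sup>2)"
    using iid.M.erlang_ith_moment_integrable[OF zero_less_one D, of 1] iid.M.erlang_ith_moment_integrable[OF zero_less_one D, of 2]
    by simp_all
  moreover have "0 \<le> X t" if "t \<in> {0<..<1}" for t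
    using X that by auto
  ultimately have "AE u in iid_uniform. (\<lambda>K. (\<Sum>k<K. X (u k)) / real K) \<longlonglongrightarrow> iid.M.expectation X"
    by (rule AE_mean_coordinates)
  then show ?thesis
    using iid.M.exponential_distributed_expectation[OF zero_less_one D] by simp
qed

lemma AE_regular_cut_sequence: "AE u in iid_uniform. regular_cut_sequence u"
  using AE_iid_uniform_interior AE_mean_ln_cut[OF disjI1[OF refl]] AE_mean_ln_cut[OF disjI2[OF refl]]
proof eventually_elim
  case (elim u)
  then interpret cut_sequence u by unfold_locales auto
  show ?case
  proof unfold_locales
    show "(\<lambda>k. ln (rest u k) / k) \<longlonglongrightarrow> -1"
      using tendsto_minus[OF elim(3)] by (simp add: ln_rest_eq sum_negf)
    \<comment> \<open>A single term is a difference of consecutive partial sums. Both have the same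
      limit after division by \<open>k\<close>, so \<open>ln (u k) / k\<close> tends to 0.\<close>
    define T where "T k = (\<Sum>i<k. - ln (u i))" for k
    have T: "(\<lambda>k. T k / real k) \<longlonglongrightarrow> 1" using elim(2) by (simp add: T_def)
    have "(\<lambda>k. real (Suc k) / real k) \<longlonglongrightarrow> 1" by real_asymp
    from tendsto_diff[OF T tendsto_mult[OF LIMSEQ_Suc[OF T] this]]
    have "(\<lambda>k. T k / real k - T (Suc k) / real (Suc k) * (real (Suc k) / real k)) \<longlonglongrightarrow> 0" by simp
    moreover have "T k / real k - T (Suc k) / real (Suc k) * (real (Suc k) / real k) = ln (u k) / real k" for k
      by (simp add: T_def diff_divide_distrib[symmetric] del: of_nat_Suc)
    ultimately show "(\<lambda>k. ln (u k) / k) \<longlonglongrightarrow> 0" by simp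
  qed
qed

text \<open>In \<open>Z k * cnj (Z j)\<close> with \<open>j < k\<close> the factors before
  \<open>j\<close> cancel. Each coordinate strictly between \<open>j\<close> and \<open>k\<close>
  contributes an independent factor with expectation of modulus \<open>r < 1\<close>, so
  correlations decay geometrically.\<close>

lemma AE_mean_cis:
  assumes \<tau>: "\<tau> \<noteq> 0"
  shows "AE u in iid_uniform. (\<lambda>K. (\<Sum>k<K. cis (\<tau> * ln (u k * rest u k))) /\<^sub>R real K) \<longlonglongrightarrow> 0"
proof -
  define a where "a t = cis (\<tau> * ln t)" for t
  define b where "b t = cis (\<tau> * ln (1 - t))" for t
  \<comment> \<open>Equal to \<open>cis (\<tau> * ln (u k * rest u k))\<close> only for cuts inside \<open>(0,1)\<close>, but for all \<open>u\<close> a product of functions of single coordinates.\<close>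
  define Z where "Z k u = a (u k) * (\<Prod>i<k. b (u i))" for k and u :: "nat \<Rightarrow> real"
  define r where "r = norm (1 / (1 + \<i> * \<tau>))"
  have [measurable]: "a \<in> borel_measurable borel" "b \<in> borel_measurable borel"
    unfolding a_def b_def by measurable
  have unit: "norm (a t) = 1" "norm (b t) = 1" for t by (simp_all add: a_def b_def)
  have unit': "z * cnj z = 1" if "norm z = 1" for z :: complex
    using that by (simp flip: complex_norm_square)
  have "norm (1 + \<i> * \<tau>) > 1"
    using \<tau> by (simp add: cmod_def)
  then have r: "0 < r" "r < 1"
    unfolding r_def norm_divide norm_one by (simp_all only: zero_less_divide_1_iff divide_less_eq_1_pos)
  have Eb: "norm (iid.M.expectation b) = r"
    unfolding b_def r_def by (simp only: integral_cis_ln)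
  have int: "integrable uniform01 h" "norm (iid.M.expectation h) \<le> 1"
    if [measurable]: "h \<in> borel_measurable borel" and h: "\<And>t. norm (h t) \<le> 1" for h :: "real \<Rightarrow> complex"
  proof -
    show "integrable uniform01 h"
      using h by (intro iid.M.integrable_const_bound[where B = 1])
        (simp_all add: measurable_cong_sets[of uniform01 borel borel borel])
    then have "iid.M.expectation (\<lambda>t. norm (h t)) \<le> iid.M.expectation (\<lambda>_. 1)"
      using h by (intro integral_mono) auto
    then show "norm (iid.M.expectation h) \<le> 1"
      by (intro order_trans[OF integral_norm_bound]) (simp add: iid.M.prob_space)
  qed
  have Zm [measurable]: "Z k \<in> borel_measurable iid_uniform" for k
    unfolding Z_def by measurable
  have Z1: "norm (Z k u) = 1" for k u
    by (simp add: Z_def norm_mult prod_norm[symmetric] unit)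
  have "AE u in iid_uniform. (\<lambda>m. (\<Sum>k<m\<^sup>2. Z k u) /\<^sub>R real (m\<^sup>2)) \<longlonglongrightarrow> 0"
  proof (rule iid_uniform.AE_squares_mean_tendsto_0[OF Zm])
    \<comment> \<open>The constant \<open>1 / r\<close> compensates for having only
      \<open>k - j - 1\<close> intermediate coordinates.\<close>
    show "(\<integral>\<^sup>+u. ennreal ((norm (\<Sum>k<K. Z k u))\<^sup>2) \<partial>iid_uniform) \<le> ennreal (2 * (1 / r) / (1 - r) * K)" for K
    proof (rule iid_uniform.nn_integral_norm_sum_sq_le)
      show "integrable iid_uniform (\<lambda>u. Z k u * cnj (Z j u))" for j k
        by (intro iid_uniform.integrable_const_bound[where B = 1]) (auto simp: norm_mult Z1)
      show "norm (iid_uniform.expectation (\<lambda>u. Z k u * cnj (Z j u))) \<le> 1 / r * r ^ (k - j)" if "j \<le> k" for j k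
      proof (cases "j = k")
        case True
        then show ?thesis
          using r iid_uniform.prob_space by (simp add: unit'[OF Z1] field_simps)
      next
        case False
        with that have "j < k" by simp
        \<comment> \<open>At \<open>j\<close> the factor \<open>b\<close> of \<open>Z k\<close>
          meets the conjugated \<open>a\<close> of \<open>Z j\<close>; at \<open>k\<close> only
          \<open>a\<close> remains. These two expectations are merely bounded by 1.\<close>
        define f where "f i = (if i = j then (\<lambda>t. b t * cnj (a t)) else if i = k then a else b)" for i
        have f: "integrable uniform01 (f i)" "norm (iid.M.expectation (f i)) \<le> 1" for i
          by (auto simp: f_def norm_mult unit intro!: int)
        have split: "(\<Prod>i\<in>{j..k}. F i) = F j * F k * (\<Prod>i\<in>{j<..<k}. F i)" for F :: "nat \<Rightarrow> complex"
        proof -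
          have "{j..k} = insert j (insert k {j<..<k})" using \<open>j < k\<close> by auto
          then show ?thesis using \<open>j < k\<close> by (simp add: mult.assoc)
        qed
        have "Z k u * cnj (Z j u) = (\<Prod>i\<in>{j..k}. f i (u i))" for u
        proof -
          have k: "{..<k} = {..<j} \<union> insert j {j<..<k}" using \<open>j < k\<close> by auto
          have "(\<Prod>i<k. b (u i)) = (\<Prod>i<j. b (u i)) * (\<Prod>i\<in>insert j {j<..<k}. b (u i))"
            unfolding k by (rule prod.union_disjoint) auto
          then have "Z k u * cnj (Z j u) = (\<Prod>i<j. b (u i) * cnj (b (u i))) *
              (b (u j) * cnj (a (u j)) * a (u k) * (\<Prod>i\<in>{j<..<k}. b (u i)))"
            by (simp only: Z_def prod.distrib complex_cnj_mult cnj_prod prod.insert finite_greaterThanLessThan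
                greaterThanLessThan_iff less_irrefl simp_thms mult_ac)
          also have "\<dots> = (\<Prod>i\<in>{j..k}. f i (u i))"
            using \<open>j < k\<close> by (simp add: split f_def unit' unit)
          finally show ?thesis .
        qed
        then have "iid_uniform.expectation (\<lambda>u. Z k u * cnj (Z j u)) = (\<Prod>i\<in>{j..k}. iid.M.expectation (f i))"
          by (simp only: integral_prod_coordinates[OF finite_atLeastAtMost f(1)])
        also have "norm \<dots> = norm (iid.M.expectation (f j)) * norm (iid.M.expectation (f k)) * (\<Prod>i\<in>{j<..<k}. norm (iid.M.expectation (f i)))"
          by (simp add: split norm_mult prod_norm)
        also have "(\<Prod>i\<in>{j<..<k}. norm (iid.M.expectation (f i))) = r ^ (k - j - 1)"
          using Eb by (simp add: f_def)
        also have "norm (iid.M.expectation (f j)) * norm (iid.M.expectation (f k)) * r ^ (k - j - 1) \<le> 1 * 1 * r ^ (k - j - 1)"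
          using r by (intro mult_mono f mult_nonneg_nonneg) auto
        also have "\<dots> = 1 / r * r ^ (k - j)"
          using r \<open>j < k\<close> by (simp add: power_diff)
        finally show ?thesis .
      qed
    qed (use r in auto)
  qed (use r in auto)
  with AE_iid_uniform_interior show ?thesis
  proof eventually_elim
    case (elim u)
    then interpret cut_sequence u by unfold_locales auto
    have "cis (\<tau> * ln (u k * rest u k)) = Z k u" for k
    proof -
      have "(\<Prod>i<m. cis (\<tau> * ln (1 - u i))) = cis (\<tau> * (\<Sum>i<m. ln (1 - u i)))" for m
        by (induction m) (simp_all add: cis_mult distrib_left)
      then show ?thesis
        using u[of k] rest_pos[of k]
        by (simp add: Z_def a_def b_def ln_mult ln_rest_eq distrib_left flip: cis_mult)
    qed
    with elim(2) show ?case
      by (intro mean_tendsto_from_squares_bounded) (simp_all add: Z1)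
  qed
qed

text \<open>There are countably many frequencies \<open>h\<close>, so their exceptional null sets
  can be united.\<close>

lemma AE_converges_to_strong_Benford:
  "AE u in iid_uniform. converges_to_strong_Benford (\<lambda>n. fragmentation_path u n)"
proof -
  have "AE u in iid_uniform. \<forall>h::int. h \<noteq> (0::int) \<longrightarrow>
      (\<lambda>K. (\<Sum>k<K. cis (2 * pi * h / ln 10 * ln (u k * rest u k))) /\<^sub>R real K) \<longlonglongrightarrow> 0"
    unfolding AE_all_countable
  proof
    fix h :: int
    show "AE u in iid_uniform. h \<noteq> (0::int) \<longrightarrow>
      (\<lambda>K. (\<Sum>k<K. cis (2 * pi * h / ln 10 * ln (u k * rest u k))) /\<^sub>R real K) \<longlonglongrightarrow> 0"
      using AE_mean_cis[of "2 * pi * h / ln 10"] by (cases "h = 0") auto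
  qed
  with AE_regular_cut_sequence show ?thesis
    by eventually_elim (auto intro: regular_cut_sequence.converges_to_strong_Benford_path)
qed

text \<open>Lists of naturals are countable, so level sets suffice, and each is described by
  finitely many coordinates.\<close>

lemma measurable_fragmentation_path:
  "(\<lambda>u. fragmentation_path u n) \<in> iid_uniform \<rightarrow>\<^sub>M count_space UNIV"
proof -
  have "{u. fragmentation_path u n = xs} \<in> sets iid_uniform" for xs
  proof -
    have [measurable]: "cut_event n xs k \<in> sets borel" for k by (rule cut_event_sets)
    have "{u \<in> space iid_uniform. n - sum_list xs = 0 \<and> (\<forall>k\<in>{..<length xs}. u k \<in> cut_event n xs k)}
            \<in> sets iid_uniform"
      by measurable
    then show ?thesis by (simp add: fragmentation_path_eq_iff)
  qed
  then show ?thesis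
    by (intro measurable_count_space_eq2_countable[THEN iffD2]) (auto simp: vimage_def)
qed

text \<open>A consequence independent of how different \<open>n\<close> are coupled, since only the
  laws occur. The path has the required law for each \<open>n\<close>, and dominated convergence for
  the indicators of the bad event turns almost sure convergence into convergence in
  probability.\<close>

lemma fragmentation_tendsto_in_probability:
  assumes s: "1 \<le> s" "s < 10" and "\<epsilon> > 0"
  shows "(\<lambda>n. measure_pmf.prob (fragmentation_pmf n)
              {xs. \<bar>significand_proportion xs s - log 10 s\<bar> > \<epsilon>}) \<longlonglongrightarrow> 0"
proof -
  let ?B = "{xs. \<bar>significand_proportion xs s - log 10 s\<bar> > \<epsilon>}"
  let ?I = "\<lambda>n u. indicator ?B (fragmentation_path u n) :: real"
  note [measurable] = measurable_fragmentation_path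
  have prob: "measure_pmf.prob (fragmentation_pmf n) ?B = iid_uniform.expectation (?I n)" for n
  proof -
    have "measure_pmf.prob (fragmentation_pmf n) ?B = (\<integral>xs. indicator ?B xs \<partial>measure_pmf (fragmentation_pmf n))"
      by simp
    also have "\<dots> = iid_uniform.expectation (?I n)"
      unfolding distr_fragmentation_path[symmetric] by (rule integral_distr) simp_all
    finally show ?thesis .
  qed
  have "(\<lambda>n. iid_uniform.expectation (?I n)) \<longlonglongrightarrow> iid_uniform.expectation (\<lambda>_. 0)"
  proof (rule integral_dominated_convergence[where w = "\<lambda>_. 1"])
    show "AE u in iid_uniform. (\<lambda>n. ?I n u) \<longlonglongrightarrow> 0"
      using AE_converges_to_strong_Benford
    proof eventually_elim
      case (elim u)
      then have "(\<lambda>n. significand_proportion (fragmentation_path u n) s) \<longlonglongrightarrow> log 10 s"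
        using s by (simp add: converges_to_strong_Benford_def)
      then have "eventually (\<lambda>n. dist (significand_proportion (fragmentation_path u n) s) (log 10 s) < \<epsilon>) sequentially"
        using \<open>\<epsilon> > 0\<close> by (rule tendstoD)
      then show ?case
        by (intro tendsto_eventually) (auto elim!: eventually_mono simp: dist_real_def)
    qed
  qed (auto split: split_indicator)
  then show ?thesis by (simp add: prob)
qed

theorem theorem1p7:
  shows "(AE u in iid_uniform. converges_to_strong_Benford (\<lambda>n. fragmentation_path u n)) \<and>
    (\<forall>s \<epsilon> :: real. 1 \<le> s \<and> s < 10 \<and> \<epsilon> > 0 \<longrightarrow>
      (\<lambda>n. measure_pmf.prob (fragmentation_pmf n)
              {xs. \<bar>significand_proportion xs s - log 10 s\<bar> > \<epsilon>}) \<longlonglongrightarrow> 0)"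
  using AE_converges_to_strong_Benford fragmentation_tendsto_in_probability by blast

end
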